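(* Let $\mathcal{A}$ be an independence algebra with universe $A$ and let $\mathcal{B}$ be a non-empty subalgebra of $\mathcal{A}$ with universe $B$. Assume $\mathcal{B}\neq\mathcal{A}$ and that either $\dim B\geq 2$, or $\langle\emptyset\rangle\neq\emptyset$ and $\dim B=1$. Let $T(\mathcal{A},\mathcal{B})$ be the semigroup of all endomorphisms of $\mathcal{A}$ whose image is contained in $B$. Then in $T(\mathcal{A},\mathcal{B})$ we have $\mathcal{D}^*=\mathcal{J}^*$.
   Context: An algebra $\mathcal{A}=\langle A;F\rangle$ has a non-empty universe $A$ and a set $F$ of finitary operations. For $X\subseteq A$, $\langle X\rangle$ is the set of all $t(a_1,\dots,a_n)$ with $t$ a term operation and $a_i\in X$ (the subalgebra generated by $X$); $\langle\emptyset\rangle$ is the set of constants, i.e. values of nullary term operations (possibly empty). $X$ is independent if $x\notin\langle X\setminus\{x\}\rangle$ for all $x\in X$; a basis of a subalgebra is an independent generating set. Exchange property (EP): for all $X\subseteq A$ and $a,b\in A$, if $b\in\langle X\cup\{a\}\rangle$ and $b\notin\langle X\rangle$ then $a\in\langle X\cup\{b\}\rangle$. Under (EP) every subalgebra has a basis, all its bases have the same cardinality (its dimension, $\dim$), and independent sets extend to bases. Free basis property (F): every map from a basis of $\mathcal{A}$ to $A$ extends to an endomorphism of $\mathcal{A}$. An independence algebra is an algebra satisfying (EP) and (F). Dimensions may be finite or infinite. Maps are written on the right and composed left to right. For a semigroup $S$ and $a,b\in S$ ($S^1$ denotes $S$ with an identity adjoined if necessary): $a\,\mathcal{L}^*\,b$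 iff for all $x,y\in S^1$, $ax=ay\Leftrightarrow bx=by$; $a\,\mathcal{R}^*\,b$ iff for all $x,y\in S^1$, $xa=ya\Leftrightarrow xb=yb$. $\mathcal{D}^*=\mathcal{L}^*\vee\mathcal{R}^*$ is the smallest equivalence relation containing both. $J^*(a)$ is the smallest (two-sided) ideal of $S$ that contains $a$ and is saturated by $\mathcal{L}^*$ and $\mathcal{R}^*$, i.e. is a union of $\mathcal{L}^*$-classes and also a union of $\mathcal{R}^*$-classes; and $a\,\mathcal{J}^*\,b$ iff $J^*(a)=J^*(b)$. *)

theory Defs
  imports "HOL-Library.FuncSet"
begin

unbundle cardinal_syntax

section \<open>Algebras and term operations\<close>

text \<open>
  A finitary operation is a pair of an arity \<open>n\<close> and a function on lists; only its values
  on lists of length \<open>n\<close> over the universe matter.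
\<close>

type_synonym 'a operation = "nat \<times> ('a list \<Rightarrow> 'a)"

definition closed_under :: "'a set \<Rightarrow> 'a operation set \<Rightarrow> bool" where
  "closed_under B F \<longleftrightarrow>
     (\<forall>(n, f) \<in> F. \<forall>xs. length xs = n \<longrightarrow> set xs \<subseteq> B \<longrightarrow> f xs \<in> B)"

definition is_algebra :: "'a set \<Rightarrow> 'a operation set \<Rightarrow> bool" where
  "is_algebra A F \<longleftrightarrow> A \<noteq> {} \<and> closed_under A F"

definition subalgebra :: "'a set \<Rightarrow> 'a operation set \<Rightarrow> 'a set \<Rightarrow> bool" where
  "subalgebra A F B \<longleftrightarrow> B \<subseteq> A \<and> closed_under B F"

inductive term_operation :: "'a operation set \<Rightarrow> nat \<Rightarrow> ('a list \<Rightarrow> 'a) \<Rightarrow> bool"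
  for F :: "'a operation set" and n :: nat where
  projection: "i < n \<Longrightarrow> term_operation F n (\<lambda>xs. xs ! i)"
| composition: "(k, f) \<in> F \<Longrightarrow> length ts = k \<Longrightarrow> (\<forall>t \<in> set ts. term_operation F n t) \<Longrightarrow>
    term_operation F n (\<lambda>xs. f (map (\<lambda>t. t xs) ts))"

text \<open>
  For \<open>X = {}\<close> only \<open>n = 0\<close> and \<open>xs = []\<close> remain, so \<open>generated F {}\<close> is the set of values of
  nullary term operations, possibly empty.
\<close>

definition generated :: "'a operation set \<Rightarrow> 'a set \<Rightarrow> 'a set" where
  "generated F X = {t xs | n t xs. term_operation F n t \<and> length xs = n \<and> set xs \<subseteq> X}"


section \<open>Independence algebras\<close>

definition independent_set :: "'a operation set \<Rightarrow> 'a set \<Rightarrow> bool" where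
  "independent_set F X \<longleftrightarrow> (\<forall>x \<in> X. x \<notin> generated F (X - {x}))"

definition basis_of :: "'a operation set \<Rightarrow> 'a set \<Rightarrow> 'a set \<Rightarrow> bool" where
  "basis_of F B X \<longleftrightarrow> X \<subseteq> B \<and> independent_set F X \<and> generated F X = B"

definition exchange_property :: "'a set \<Rightarrow> 'a operation set \<Rightarrow> bool" where
  "exchange_property A F \<longleftrightarrow>
     (\<forall>X a b. X \<subseteq> A \<longrightarrow> a \<in> A \<longrightarrow> b \<in> A \<longrightarrow>
        b \<in> generated F (X \<union> {a}) \<longrightarrow> b \<notin> generated F X \<longrightarrow> a \<in> generated F (X \<union> {b}))"

text \<open>
  Endomorphisms are extensional functions (equal to \<open>undefined\<close> outside \<open>A\<close>), so that equality
  of HOL functions is equality of maps on \<open>A\<close>.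
\<close>

definition endomorphisms :: "'a set \<Rightarrow> 'a operation set \<Rightarrow> ('a \<Rightarrow> 'a) set" where
  "endomorphisms A F =
     {\<theta> \<in> A \<rightarrow>\<^sub>E A. \<forall>(n, f) \<in> F. \<forall>xs. length xs = n \<longrightarrow> set xs \<subseteq> A \<longrightarrow>
        \<theta> (f xs) = f (map \<theta> xs)}"

definition free_basis_property :: "'a set \<Rightarrow> 'a operation set \<Rightarrow> bool" where
  "free_basis_property A F \<longleftrightarrow>
     (\<forall>X g. basis_of F A X \<longrightarrow> g \<in> X \<rightarrow> A \<longrightarrow>
        (\<exists>\<theta> \<in> endomorphisms A F. \<forall>x \<in> X. \<theta> x = g x))"

definition independence_algebra :: "'a set \<Rightarrow> 'a operation set \<Rightarrow> bool" where
  "independence_algebra A F \<longleftrightarrow>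
     is_algebra A F \<and> exchange_property A F \<and> free_basis_property A F"

text \<open>
  The dimension is a cardinal. The choice of basis is immaterial under the exchange property,
  where every subalgebra has a basis and any two bases are equipotent.
\<close>

definition dimension :: "'a operation set \<Rightarrow> 'a set \<Rightarrow> 'a rel" where
  "dimension F B = card_of (SOME X. basis_of F B X)"


section \<open>The semigroup of endomorphisms with restricted range\<close>

definition T_sgp :: "'a set \<Rightarrow> 'a operation set \<Rightarrow> 'a set \<Rightarrow> ('a \<Rightarrow> 'a) set" where
  "T_sgp A F B = {\<theta> \<in> endomorphisms A F. \<theta> ` A \<subseteq> B}"

text \<open>Maps compose from left to right: the product of \<open>\<alpha>\<close> and \<open>\<beta>\<close> applies \<open>\<alpha>\<close> first.\<close>

definition map_mult :: "'a set \<Rightarrow> ('a \<Rightarrow> 'a) \<Rightarrow> ('a \<Rightarrow> 'a) \<Rightarrow> ('a \<Rightarrow> 'a)" where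
  "map_mult A \<alpha> \<beta> = compose A \<beta> \<alpha>"


section \<open>Starred Green's relations of a semigroup\<close>

text \<open>
  A semigroup is given by its carrier \<open>S\<close> and multiplication \<open>m\<close>. The elements of \<open>S\<^sup>1\<close> are
  represented as \<open>Some s\<close> for \<open>s \<in> S\<close>; the element \<open>None\<close> is the adjoined identity and belongs to
  \<open>S\<^sup>1\<close> only if \<open>S\<close> itself has no identity.
\<close>

definition with_one :: "'s set \<Rightarrow> ('s \<Rightarrow> 's \<Rightarrow> 's) \<Rightarrow> 's option set" where
  "with_one S m =
     (if \<exists>e \<in> S. \<forall>x \<in> S. m e x = x \<and> m x e = x then Some ` S else insert None (Some ` S))"

fun mult_one :: "('s \<Rightarrow> 's \<Rightarrow> 's) \<Rightarrow> 's option \<Rightarrow> 's option \<Rightarrow> 's option" where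
  "mult_one m None y = y"
| "mult_one m (Some x) None = Some x"
| "mult_one m (Some x) (Some y) = Some (m x y)"

definition L_star :: "'s set \<Rightarrow> ('s \<Rightarrow> 's \<Rightarrow> 's) \<Rightarrow> 's rel" where
  "L_star S m = {(a, b) \<in> S \<times> S. \<forall>x \<in> with_one S m. \<forall>y \<in> with_one S m.
     mult_one m (Some a) x = mult_one m (Some a) y \<longleftrightarrow>
     mult_one m (Some b) x = mult_one m (Some b) y}"

definition R_star :: "'s set \<Rightarrow> ('s \<Rightarrow> 's \<Rightarrow> 's) \<Rightarrow> 's rel" where
  "R_star S m = {(a, b) \<in> S \<times> S. \<forall>x \<in> with_one S m. \<forall>y \<in> with_one S m.
     mult_one m x (Some a) = mult_one m y (Some a) \<longleftrightarrow>
     mult_one m x (Some b) = mult_one m y (Some b)}"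

definition D_star :: "'s set \<Rightarrow> ('s \<Rightarrow> 's \<Rightarrow> 's) \<Rightarrow> 's rel" where
  "D_star S m = \<Inter> {E. equiv S E \<and> L_star S m \<subseteq> E \<and> R_star S m \<subseteq> E}"

definition two_sided_ideal :: "'s set \<Rightarrow> ('s \<Rightarrow> 's \<Rightarrow> 's) \<Rightarrow> 's set \<Rightarrow> bool" where
  "two_sided_ideal S m I \<longleftrightarrow>
     I \<subseteq> S \<and> I \<noteq> {} \<and> (\<forall>s \<in> S. \<forall>x \<in> I. m s x \<in> I \<and> m x s \<in> I)"

definition saturated_by :: "'s set \<Rightarrow> 's rel \<Rightarrow> 's set \<Rightarrow> bool" where
  "saturated_by S E I \<longleftrightarrow> (\<exists>K \<subseteq> S // E. I = \<Union> K)"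

definition J_star_ideal :: "'s set \<Rightarrow> ('s \<Rightarrow> 's \<Rightarrow> 's) \<Rightarrow> 's \<Rightarrow> 's set" where
  "J_star_ideal S m a =
     \<Inter> {I. two_sided_ideal S m I \<and> a \<in> I \<and>
        saturated_by S (L_star S m) I \<and> saturated_by S (R_star S m) I}"

definition J_star :: "'s set \<Rightarrow> ('s \<Rightarrow> 's \<Rightarrow> 's) \<Rightarrow> 's rel" where
  "J_star S m = {(a, b) \<in> S \<times> S. J_star_ideal S m a = J_star_ideal S m b}"

end

theory Submission
  imports Defs
begin

text \<open>
  The inclusion of \<open>\<D>\<^sup>*\<close> in \<open>\<J>\<^sup>*\<close> holds in every semigroup. For the converse, call the dimension
  of the image of \<open>\<alpha>\<close> its rank. Two elements are \<open>\<L>\<^sup>*\<close>-related iff they have the same image,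
  and elements with the same kernel are \<open>\<R>\<^sup>*\<close>-related; hence elements of equal rank are
  \<open>\<D>\<^sup>*\<close>-related. Conversely, \<open>\<alpha> \<R>\<^sup>* \<gamma>\<close> implies that \<open>\<alpha>\<close> and \<open>\<gamma>\<close> have equal rank or that both
  are nonregular with the same kernel on \<open>B\<close>, and in the latter case every rank between theirs
  is attained in the same \<open>\<R>\<^sup>*\<close>-class. So each \<open>\<D>\<^sup>*\<close>-class is the set of elements whose rank
  lies in some convex set of cardinals. The elements of rank at most that of some member of a
  given \<open>\<D>\<^sup>*\<close>-class then form an ideal saturated by \<open>\<L>\<^sup>*\<close> and \<open>\<R>\<^sup>*\<close>, which therefore contains
  the corresponding \<open>J\<^sup>*\<close>, and convexity gives the claim.
\<close>

subsection \<open>Generated subalgebras\<close>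

lemma generatedI: "term_operation F (length xs) t \<Longrightarrow> set xs \<subseteq> X \<Longrightarrow> t xs \<in> generated F X"
  unfolding generated_def by blast

lemma generatedE:
  assumes "x \<in> generated F X"
  obtains t xs where "term_operation F (length xs) t" "set xs \<subseteq> X" "x = t xs"
  using assms unfolding generated_def by blast

lemma generated_superset: "X \<subseteq> generated F X"
proof
  fix x assume "x \<in> X"
  then show "x \<in> generated F X"
    using generatedI[of F "[x]" "\<lambda>xs. xs ! 0" X] by (simp add: term_operation.projection)
qed

lemma generated_base: "x \<in> X \<Longrightarrow> x \<in> generated F X"
  by (rule subsetD[OF generated_superset])

lemma term_operation_closed:
  assumes "term_operation F n t" "closed_under C F" "length xs = n" "set xs \<subseteq> C"
  shows "t xs \<in> C"
  using assms(1)
proof induction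
  case (projection i)
  then show ?case using assms(3,4) by (auto simp: subset_iff)
next
  case (composition k f ts)
  then have "set (map (\<lambda>t. t xs) ts) \<subseteq> C" "length (map (\<lambda>t. t xs) ts) = k"
    by auto
  then show ?case using assms(2) composition(1) unfolding closed_under_def by blast
qed

lemma generated_least:
  assumes "X \<subseteq> C" "closed_under C F"
  shows "generated F X \<subseteq> C"
proof
  fix x assume "x \<in> generated F X"
  then show "x \<in> C"
    using assms by (elim generatedE) (simp add: term_operation_closed)
qed

lemma generated_mono: "X \<subseteq> Y \<Longrightarrow> generated F X \<subseteq> generated F Y"
  unfolding generated_def by blast

text \<open>An argument list has only finitely many entries.\<close>

lemma generated_finite:
  assumes "x \<in> generated F X"
  obtains Y where "finite Y" "Y \<subseteq> X" "x \<in> generated F Y"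
  using assms unfolding generated_def by blast

text \<open>
  Elements with different argument lists are combined by evaluating all term operations on the
  concatenation of these lists.
\<close>

lemma generated_closed: "closed_under (generated F X) F"
  unfolding closed_under_def
proof safe
  fix f and xs :: "'a list"
  assume f: "(length xs, f) \<in> F" and xs: "set xs \<subseteq> generated F X"
  have "\<exists>ys. set ys \<subseteq> X \<and> x \<in> generated F (set ys)" if "x \<in> set xs" for x
  proof -
    have "x \<in> generated F X"
      using that xs by blast
    then show ?thesis
      by (elim generatedE) (auto intro: generatedI)
  qed
  then obtain h where h: "\<And>x. x \<in> set xs \<Longrightarrow> set (h x) \<subseteq> X \<and> x \<in> generated F (set (h x))"
    by metis
  define zs where "zs = concat (map h xs)"
  \<comment> \<open>Over the single argument list \<open>zs\<close>, applying a basic operation to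
    values of term operations gives the value of a composed term operation, so \<open>V\<close> is
    closed.\<close>
  define V where "V = (\<lambda>t. t zs) ` {t. term_operation F (length zs) t}"
  have V_I: "t zs \<in> V" if "term_operation F (length zs) t" for t
    unfolding V_def using that by (intro image_eqI[of _ _ t]) simp_all
  have V_closed: "closed_under V F"
    unfolding closed_under_def
  proof safe
    fix g and vs :: "'a list"
    assume g: "(length vs, g) \<in> F" and "set vs \<subseteq> V"
    then have "vs \<in> lists V"
      by auto
    then obtain ts where ts: "vs = map (\<lambda>t. t zs) ts" "\<forall>t \<in> set ts. term_operation F (length zs) t"
      unfolding V_def lists_image by auto
    have "term_operation F (length zs) (\<lambda>xs. g (map (\<lambda>t. t xs) ts))"
      using g ts by (intro term_operation.composition) simp_all
    from V_I[OF this] show "g vs \<in> V"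
      by (simp add: ts(1))
  qed
  have zs_V: "set zs \<subseteq> V"
  proof
    fix z assume "z \<in> set zs"
    then obtain i where "i < length zs" "z = zs ! i"
      by (auto simp: in_set_conv_nth)
    then show "z \<in> V"
      using V_I[of "\<lambda>xs. xs ! i"] by (simp add: term_operation.projection)
  qed
  have "set xs \<subseteq> V"
  proof
    fix x assume x: "x \<in> set xs"
    then have "set (h x) \<subseteq> set zs"
      unfolding zs_def by auto
    with zs_V have "set (h x) \<subseteq> V"
      by (rule subset_trans[rotated])
    then show "x \<in> V"
      using h[OF x] generated_least[OF _ V_closed] by (metis subsetD)
  qed
  then have "f xs \<in> V"
    using V_closed f unfolding closed_under_def by blast
  then obtain t where "term_operation F (length zs) t" "f xs = t zs"
    unfolding V_def by (elim imageE) simp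
  moreover have "set zs \<subseteq> X"
    using h by (auto simp: zs_def)
  ultimately show "f xs \<in> generated F X"
    by (simp add: generatedI)
qed

lemma generated_subset_iff: "generated F X \<subseteq> generated F Y \<longleftrightarrow> X \<subseteq> generated F Y"
proof
  show "generated F X \<subseteq> generated F Y \<Longrightarrow> X \<subseteq> generated F Y"
    by (rule subset_trans[OF generated_superset])
qed (rule generated_least[OF _ generated_closed])

lemma generated_id: "closed_under C F \<Longrightarrow> generated F C = C"
  by (rule subset_antisym[OF generated_least[OF order_refl] generated_superset])

lemma generated_eqI: "X \<subseteq> generated F Y \<Longrightarrow> Y \<subseteq> generated F X \<Longrightarrow> generated F X = generated F Y"
  by (simp add: generated_subset_iff subset_antisym)


subsection \<open>Independent sets and bases\<close>

lemma independent_set_mono: "independent_set F X \<Longrightarrow> Y \<subseteq> X \<Longrightarrow> independent_set F Y"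
  unfolding independent_set_def
proof
  fix x assume "\<forall>x\<in>X. x \<notin> generated F (X - {x})" "Y \<subseteq> X" "x \<in> Y"
  moreover from this have "generated F (Y - {x}) \<subseteq> generated F (X - {x})"
    by (intro generated_mono) blast
  ultimately show "x \<notin> generated F (Y - {x})"
    by blast
qed

text \<open>A dependence of \<open>x\<close> on the rest of \<open>X\<close> already occurs over
  finitely many points. This makes unions of chains of independent sets independent, as Zorn's lemma
  requires.\<close>

lemma independent_set_finite_character:
  assumes "\<And>Y. finite Y \<Longrightarrow> Y \<subseteq> X \<Longrightarrow> independent_set F Y"
  shows "independent_set F X"
  unfolding independent_set_def
proof safe
  fix x assume x: "x \<in> X" "x \<in> generated F (X - {x})"
  obtain Y where Y: "finite Y" "Y \<subseteq> X - {x}" "x \<in> generated F Y"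
    by (rule generated_finite[OF x(2)])
  then have "independent_set F (insert x Y)"
    using x(1) by (intro assms) auto
  then have "x \<notin> generated F (insert x Y - {x})"
    unfolding independent_set_def by blast
  moreover have "insert x Y - {x} = Y"
    using Y by blast
  ultimately show False
    using Y by simp
qed

lemma independent_subset_generated:
  assumes "independent_set F X" "K \<subseteq> X" "x \<in> X" "x \<in> generated F K"
  shows "x \<in> K"
proof (rule ccontr)
  assume "x \<notin> K"
  then have "K \<subseteq> X - {x}"
    using assms(2) by blast
  from generated_mono[OF this] show False
    using assms unfolding independent_set_def by blast
qed

subsection \<open>Starred Green's relations\<close>

lemma equiv_L_star: "equiv S (L_star S m)"
  unfolding L_star_def by (auto intro!: equivI refl_onI symI transI)

lemma equiv_R_star: "equiv S (R_star S m)"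
  unfolding R_star_def by (auto intro!: equivI refl_onI symI transI)

lemma equiv_D_star: "equiv S (D_star S m)"
proof (rule equivI)
  have "equiv S (S \<times> S)"
    by (auto intro!: equivI refl_onI symI transI)
  moreover have "L_star S m \<subseteq> S \<times> S" "R_star S m \<subseteq> S \<times> S"
    unfolding L_star_def R_star_def by auto
  ultimately show "D_star S m \<subseteq> S \<times> S"
    unfolding D_star_def by (intro Inter_lower) simp
  show "refl_on S (D_star S m)"
    unfolding D_star_def by (intro refl_onI InterI) (auto elim!: equivE dest: refl_onD)
  show "sym (D_star S m)"
  proof (rule symI)
    fix x y assume xy: "(x, y) \<in> D_star S m"
    have "(y, x) \<in> E" if "equiv S E" "L_star S m \<subseteq> E" "R_star S m \<subseteq> E" for E
    proof -
      have "(x, y) \<in> E"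
        using xy that unfolding D_star_def by simp
      then show ?thesis
        using that(1) by (meson equivE symD)
    qed
    then show "(y, x) \<in> D_star S m"
      unfolding D_star_def by simp
  qed
  show "trans (D_star S m)"
  proof (rule transI)
    fix x y z assume xyz: "(x, y) \<in> D_star S m" "(y, z) \<in> D_star S m"
    have "(x, z) \<in> E" if "equiv S E" "L_star S m \<subseteq> E" "R_star S m \<subseteq> E" for E
    proof -
      have "(x, y) \<in> E" "(y, z) \<in> E"
        using xyz that unfolding D_star_def by simp_all
      then show ?thesis
        using that(1) by (meson equivE transD)
    qed
    then show "(x, z) \<in> D_star S m"
      unfolding D_star_def by simp
  qed
qed

lemma L_star_subset_D_star: "L_star S m \<subseteq> D_star S m"
  unfolding D_star_def by blast

lemma R_star_subset_D_star: "R_star S m \<subseteq> D_star S m"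
  unfolding D_star_def by blast

lemma D_star_least: "equiv S E \<Longrightarrow> L_star S m \<subseteq> E \<Longrightarrow> R_star S m \<subseteq> E \<Longrightarrow> D_star S m \<subseteq> E"
  unfolding D_star_def by blast

text \<open>Replaces unions of classes by closure under the relation, the form in which saturation
  is used and checked later.\<close>

lemma saturated_by_iff:
  assumes "equiv S E"
  shows "saturated_by S E I \<longleftrightarrow> I \<subseteq> S \<and> (\<forall>(x, y) \<in> E. x \<in> I \<longrightarrow> y \<in> I)"
proof
  assume "saturated_by S E I"
  then obtain K where K: "K \<subseteq> S // E" "I = \<Union>K"
    unfolding saturated_by_def by blast
  have "I \<subseteq> S"
    using Union_quotient[OF assms] K by blast
  moreover have "y \<in> I" if xy: "(x, y) \<in> E" "x \<in> I" for x y
  proof -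
    obtain c where c: "c \<in> K" "x \<in> c"
      using xy(2) K(2) by blast
    then have "y \<in> c"
      using K(1) xy(1) in_quotient_imp_closed[OF assms] by blast
    with c(1) show ?thesis
      unfolding K(2) by blast
  qed
  ultimately show "I \<subseteq> S \<and> (\<forall>(x, y) \<in> E. x \<in> I \<longrightarrow> y \<in> I)"
    by blast
next
  assume I: "I \<subseteq> S \<and> (\<forall>(x, y) \<in> E. x \<in> I \<longrightarrow> y \<in> I)"
  define K where "K = (\<lambda>x. E `` {x}) ` I"
  have "K \<subseteq> S // E"
    using I unfolding K_def by (auto intro: quotientI)
  moreover have "\<Union>K \<subseteq> I"
    using I unfolding K_def by auto
  moreover have "I \<subseteq> \<Union>K"
    using I equiv_class_self[OF assms] unfolding K_def by blast
  ultimately show "saturated_by S E I"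
    unfolding saturated_by_def by blast
qed

text \<open>Since J* is an equivalence, minimality of D* leaves L* and R* to check. A saturated set
  contains both or neither of two related elements, so the two families of ideals being intersected
  coincide.\<close>

lemma D_star_subset_J_star: "D_star S m \<subseteq> J_star S m"
proof (rule D_star_least)
  show "equiv S (J_star S m)"
    unfolding J_star_def by (auto intro!: equivI refl_onI symI transI)
  have mem_iff: "a \<in> I \<longleftrightarrow> b \<in> I"
    if "equiv S E" "(a, b) \<in> E" "saturated_by S E I" for E I a b
  proof -
    have "(b, a) \<in> E"
      using that(1,2) by (meson equivE symD)
    then show ?thesis
      using that by (auto simp: saturated_by_iff)
  qed
  show "L_star S m \<subseteq> J_star S m"
  proof (rule subrelI)
    fix a b assume ab: "(a, b) \<in> L_star S m"
    have "a \<in> S" "b \<in> S"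
      using ab unfolding L_star_def by auto
    with mem_iff[OF equiv_L_star ab] show "(a, b) \<in> J_star S m"
      unfolding J_star_def J_star_ideal_def by (auto intro!: arg_cong[where f = Inter])
  qed
  show "R_star S m \<subseteq> J_star S m"
  proof (rule subrelI)
    fix a b assume ab: "(a, b) \<in> R_star S m"
    have "a \<in> S" "b \<in> S"
      using ab unfolding R_star_def by auto
    with mem_iff[OF equiv_R_star ab] show "(a, b) \<in> J_star S m"
      unfolding J_star_def J_star_ideal_def by (auto intro!: arg_cong[where f = Inter])
  qed
qed


subsection \<open>Independence algebras\<close>

text \<open>Embed \<open>K\<close> into \<open>M\<close> by \<open>f\<close> and compare what is
  left over on both sides. It serves to choose part of a basis with prescribed size containing a
  given independent set.\<close>

lemma card_between:
  assumes "K \<subseteq> X" "|K| \<le>o |M|" "|M| \<le>o |X|"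
  obtains L where "K \<subseteq> L" "L \<subseteq> X" "|L| =o |M|"
proof -
  obtain f where f: "inj_on f K" "f ` K \<subseteq> M"
    using assms(2) unfolding card_of_ordLeq[symmetric] by blast
  have bij: "bij_betw f K (f ` K)"
    using f(1) by (rule inj_on_imp_bij_betw)
  \<comment> \<open>Glues \<open>f\<close> to a bijection between sets disjoint from
    \<open>K\<close> and from its image.\<close>
  have join: "\<exists>h. bij_betw h (K \<union> P) (f ` K \<union> Q)"
    if g: "bij_betw g P Q" "K \<inter> P = {}" "f ` K \<inter> Q = {}" for g P Q
  proof -
    have "bij_betw (\<lambda>x. if x \<in> K then f x else g x) K (f ` K)"
      using bij by (rule bij_betw_cong[THEN iffD1, rotated]) simp
    moreover have "bij_betw (\<lambda>x. if x \<in> K then f x else g x) P Q"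
      using g(1) by (rule bij_betw_cong[THEN iffD1, rotated]) (use g(2) in auto)
    ultimately show ?thesis
      using bij_betw_combine g(3) by blast
  qed
  have "|M - f ` K| \<le>o |X - K| \<or> |X - K| \<le>o |M - f ` K|"
    by (intro ordLeq_total card_of_Well_order)
  then show thesis
  proof
    \<comment> \<open>Here \<open>L\<close> is \<open>K\<close> together with a copy, inside
      \<open>X - K\<close>, of the part of \<open>M\<close> that \<open>f\<close> misses.\<close>
    assume "|M - f ` K| \<le>o |X - K|"
    then obtain g where g: "inj_on g (M - f ` K)" "g ` (M - f ` K) \<subseteq> X - K"
      unfolding card_of_ordLeq[symmetric] by blast
    have bij': "bij_betw (inv_into (M - f ` K) g) (g ` (M - f ` K)) (M - f ` K)"
      using g(1) by (intro bij_betw_inv_into inj_on_imp_bij_betw)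
    have "K \<inter> g ` (M - f ` K) = {}"
      using g(2) by blast
    from join[OF bij' this Diff_disjoint] have "|K \<union> g ` (M - f ` K)| =o |f ` K \<union> (M - f ` K)|"
      unfolding card_of_ordIso .
    moreover have "f ` K \<union> (M - f ` K) = M"
      using f(2) by blast
    ultimately have "|K \<union> g ` (M - f ` K)| =o |M|"
      by simp
    then show thesis
      using that[of "K \<union> g ` (M - f ` K)"] g(2) assms(1) by blast
  next
    \<comment> \<open>Now all of \<open>X\<close> embeds into \<open>M\<close>, so
      \<open>L = X\<close> has the right size.\<close>
    assume "|X - K| \<le>o |M - f ` K|"
    then obtain g where g: "inj_on g (X - K)" "g ` (X - K) \<subseteq> M - f ` K"
      unfolding card_of_ordLeq[symmetric] by blast
    have "f ` K \<inter> g ` (X - K) = {}"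
      using g(2) by blast
    from join[OF inj_on_imp_bij_betw[OF g(1)] Diff_disjoint this]
    have "|K \<union> (X - K)| =o |f ` K \<union> g ` (X - K)|"
      unfolding card_of_ordIso .
    moreover have "K \<union> (X - K) = X"
      using assms(1) by blast
    moreover have "|f ` K \<union> g ` (X - K)| \<le>o |M|"
      using f(2) g(2) by (intro card_of_mono1) blast
    ultimately have "|X| \<le>o |M|"
      using ordIso_ordLeq_trans by metis
    then show thesis
      using that[of X] assms by (simp add: ordIso_iff_ordLeq)
  qed
qed

locale indep_algebra =
  fixes A :: "'a set" and F :: "'a operation set"
  assumes indep_algebra: "independence_algebra A F"
begin

abbreviation gen :: "'a set \<Rightarrow> 'a set" where "gen \<equiv> generated F"

lemma A_closed: "closed_under A F"
  using indep_algebra unfolding independence_algebra_def is_algebra_def by blast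

lemma exchange:
  "X \<subseteq> A \<Longrightarrow> a \<in> A \<Longrightarrow> b \<in> A \<Longrightarrow> b \<in> gen (insert a X) \<Longrightarrow> b \<notin> gen X \<Longrightarrow> a \<in> gen (insert b X)"
  using indep_algebra unfolding independence_algebra_def exchange_property_def by simp

lemma gen_subset: "X \<subseteq> A \<Longrightarrow> gen X \<subseteq> A"
  by (simp add: A_closed generated_least)

text \<open>If some \<open>x\<close> of \<open>X\<close> became dependent after adding
  \<open>a\<close>, exchanging \<open>x\<close> and \<open>a\<close> would put \<open>a\<close> into
  \<open>gen X\<close>.\<close>

lemma independent_insert:
  assumes "independent_set F X" "X \<subseteq> A" "a \<in> A" "a \<notin> gen X"
  shows "independent_set F (insert a X)"
proof -
  have "a \<notin> X"
    using assms(4) generated_base by metis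
  have False if x: "x \<in> X" "x \<in> gen (insert a X - {x})" for x
  proof -
    have "insert a X - {x} = insert a (X - {x})"
      using x \<open>a \<notin> X\<close> by blast
    then have "a \<in> gen (insert x (X - {x}))"
      using exchange[of "X - {x}" a x] x assms unfolding independent_set_def by auto
    with assms(4) show False
      using x by (simp add: insert_absorb)
  qed
  moreover have "insert a X - {a} = X"
    using \<open>a \<notin> X\<close> by blast
  ultimately show ?thesis
    using assms(4) unfolding independent_set_def by auto
qed

text \<open>By Zorn's lemma there is a maximal independent set between \<open>X\<close> and
  \<open>Y\<close>. It generates every point of \<open>Y\<close>, since otherwise
  \<open>independent_insert\<close> would enlarge it.\<close>

lemma independent_extend:
  assumes "independent_set F X" "X \<subseteq> Y" "Y \<subseteq> A"
  obtains Z where "X \<subseteq> Z" "Z \<subseteq> Y" "independent_set F Z" "gen Z = gen Y"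
proof -
  define \<Z> where "\<Z> = {Z. X \<subseteq> Z \<and> Z \<subseteq> Y \<and> independent_set F Z}"
  have "\<exists>M\<in>\<Z>. \<forall>Z\<in>\<Z>. M \<subseteq> Z \<longrightarrow> Z = M"
  proof (rule subset_Zorn_nonempty)
    show "\<Z> \<noteq> {}" using assms unfolding \<Z>_def by blast
  next
    fix \<C> assume C: "\<C> \<noteq> {}" "subset.chain \<Z> \<C>"
    then have sub: "\<C> \<subseteq> \<Z>"
      by (simp add: subset_chain_def)
    have "independent_set F (\<Union>\<C>)"
    proof (rule independent_set_finite_character)
      fix V assume "finite V" "V \<subseteq> \<Union>\<C>"
      from finite_subset_Union_chain[OF this C] obtain M where M: "M \<in> \<C>" "V \<subseteq> M" .
      then have "independent_set F M"
        using sub unfolding \<Z>_def by blast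
      then show "independent_set F V"
        using M(2) by (rule independent_set_mono)
    qed
    then show "\<Union>\<C> \<in> \<Z>"
      using sub C(1) unfolding \<Z>_def by blast
  qed
  then obtain M where M: "M \<in> \<Z>" "\<And>Z. Z \<in> \<Z> \<Longrightarrow> M \<subseteq> Z \<Longrightarrow> Z = M"
    by blast
  have "Y \<subseteq> gen M"
  proof
    fix y assume y: "y \<in> Y"
    show "y \<in> gen M"
    proof (rule ccontr)
      assume "y \<notin> gen M"
      then have "insert y M \<in> \<Z>"
        using M(1) y assms(3) independent_insert[of M y] unfolding \<Z>_def by auto
      then have "insert y M = M"
        using M(2)[of "insert y M"] by auto
      then show False
        using \<open>y \<notin> gen M\<close> generated_base[of y M] by blast
    qed
  qed
  moreover have "M \<subseteq> gen Y"
    using M(1) by (intro subset_trans[OF _ generated_superset]) (simp add: \<Z>_def)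
  ultimately have "gen M = gen Y"
    by (rule generated_eqI[rotated])
  with M(1) show thesis
    unfolding \<Z>_def by (intro that[of M]) simp_all
qed

text \<open>
  The Steinitz exchange lemma for sets of any cardinality: Zorn's lemma yields a maximal partial
  injection \<open>R\<close> from \<open>X\<close> to \<open>Y\<close> such that replacing each point of its domain by its image
  preserves independence.
\<close>

lemma independent_card_le:
  assumes X: "independent_set F X" "X \<subseteq> gen Y" and Y: "Y \<subseteq> A"
  shows "|X| \<le>o |Y|"
proof -
  \<comment> \<open>A pair \<open>(x, y)\<close> records that \<open>x\<close> is replaced by
    \<open>y\<close>. The disjointness clause forbids inserting a point of \<open>X\<close> that is
    still in place.\<close>
  define \<R> where "\<R> = {R. R \<subseteq> X \<times> Y \<and> inj_on fst R \<and> inj_on snd R \<and>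
    (X - fst ` R) \<inter> snd ` R = {} \<and> independent_set F ((X - fst ` R) \<union> snd ` R)}"
  have "X \<subseteq> A"
    using X(2) gen_subset[OF Y] by blast
  have "\<exists>M\<in>\<R>. \<forall>R\<in>\<R>. M \<subseteq> R \<longrightarrow> R = M"
  proof (rule subset_Zorn_nonempty)
    have "{} \<in> \<R>"
      using X(1) unfolding \<R>_def by simp
    then show "\<R> \<noteq> {}" by blast
  next
    fix \<C> assume C: "\<C> \<noteq> {}" "subset.chain \<R> \<C>"
    then have sub: "\<C> \<subseteq> \<R>"
      by (simp add: subset_chain_def)
    have member: "\<exists>R\<in>\<C>. P \<subseteq> R" if "finite P" "P \<subseteq> \<Union>\<C>" for P
      using finite_subset_Union_chain[OF that C] by metis
    have inj: "inj_on f (\<Union>\<C>)" if "\<And>R. R \<in> \<C> \<Longrightarrow> inj_on f R" for f :: "'a \<times> 'a \<Rightarrow> 'a"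
    proof (rule inj_onI)
      fix p q assume pq: "p \<in> \<Union>\<C>" "q \<in> \<Union>\<C>" "f p = f q"
      then obtain R where "R \<in> \<C>" "{p, q} \<subseteq> R"
        using member[of "{p, q}"] by auto
      then show "p = q"
        using that pq(3) by (auto dest: inj_onD)
    qed
    have "independent_set F ((X - fst ` \<Union>\<C>) \<union> snd ` \<Union>\<C>)"
    proof (rule independent_set_finite_character)
      fix V assume V: "finite V" "V \<subseteq> (X - fst ` \<Union>\<C>) \<union> snd ` \<Union>\<C>"
      \<comment> \<open>The inserted points in \<open>V\<close> come from finitely many pairs, which
        lie in one member \<open>R\<close> of the chain; the other points of \<open>V\<close> are
        unreplaced by the union, hence also by \<open>R\<close>.\<close>
      have "finite (V \<inter> snd ` \<Union>\<C>)" "V \<inter> snd ` \<Union>\<C> \<subseteq> snd ` \<Union>\<C>"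
        using V(1) by auto
      then obtain P where P: "P \<subseteq> \<Union>\<C>" "finite P" "V \<inter> snd ` \<Union>\<C> = snd ` P"
        by (meson finite_subset_image)
      then obtain R where R: "R \<in> \<C>" "P \<subseteq> R"
        using member by blast
      have "V \<subseteq> (X - fst ` R) \<union> snd ` R"
        using V(2) P(3) R by blast
      moreover have "independent_set F ((X - fst ` R) \<union> snd ` R)"
        using R(1) sub unfolding \<R>_def by blast
      ultimately show "independent_set F V"
        using independent_set_mono by blast
    qed
    moreover have "(X - fst ` \<Union>\<C>) \<inter> snd ` \<Union>\<C> = {}"
    proof (rule ccontr)
      assume "(X - fst ` \<Union>\<C>) \<inter> snd ` \<Union>\<C> \<noteq> {}"
      then obtain R p where "R \<in> \<C>" "p \<in> R" "snd p \<in> X - fst ` R"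
        by blast
      then show False
        using sub unfolding \<R>_def by blast
    qed
    moreover have "inj_on fst (\<Union>\<C>)" "inj_on snd (\<Union>\<C>)"
      using sub unfolding \<R>_def by (auto intro!: inj)
    moreover have "\<Union>\<C> \<subseteq> X \<times> Y"
      using sub unfolding \<R>_def by blast
    ultimately show "\<Union>\<C> \<in> \<R>"
      unfolding \<R>_def by blast
  qed
  then obtain M where M: "M \<in> \<R>" "\<And>R. R \<in> \<R> \<Longrightarrow> M \<subseteq> R \<Longrightarrow> R = M"
    by blast
  have M': "M \<subseteq> X \<times> Y" "inj_on fst M" "inj_on snd M" "(X - fst ` M) \<inter> snd ` M = {}"
    "independent_set F ((X - fst ` M) \<union> snd ` M)"
    using M(1) unfolding \<R>_def by auto
  have "X \<subseteq> fst ` M"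
  proof (rule ccontr)
    assume "\<not> X \<subseteq> fst ` M"
    then obtain x where x: "x \<in> X" "x \<notin> fst ` M"
      by blast
    define I where "I = (X - fst ` M) \<union> snd ` M"
    have "I \<subseteq> A"
      using M'(1) \<open>X \<subseteq> A\<close> Y unfolding I_def by auto
    have "x \<in> I" "independent_set F I"
      using x M' unfolding I_def by auto
    then have "x \<notin> gen (I - {x})"
      unfolding independent_set_def by blast
    \<comment> \<open>Otherwise \<open>x\<close>, lying in \<open>gen Y\<close>, would lie in
      \<open>gen (I - {x})\<close>. Hence some \<open>y\<close> can take the place of
      \<open>x\<close>, contradicting maximality.\<close>
    then have "\<not> Y \<subseteq> gen (I - {x})"
      using x(1) X(2) generated_subset_iff[of F Y "I - {x}"] by blast
    then obtain y where y: "y \<in> Y" "y \<notin> gen (I - {x})"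
      by blast
    then have yI: "y \<notin> I - {x}"
      using generated_base[of y "I - {x}"] by blast
    have indep: "independent_set F (insert y (I - {x}))"
      using independent_insert[of "I - {x}" y] y Y \<open>I \<subseteq> A\<close>
        independent_set_mono[OF \<open>independent_set F I\<close>] by blast
    have "x \<notin> snd ` M"
      using x M'(4) by blast
    then have ysnd: "y \<notin> snd ` M"
      using yI unfolding I_def by blast
    have eq: "(X - fst ` insert (x, y) M) \<union> snd ` insert (x, y) M = insert y (I - {x})"
      using \<open>x \<notin> snd ` M\<close> unfolding I_def by auto
    have "(X - fst ` insert (x, y) M) \<inter> snd ` insert (x, y) M = {}"
      using M'(4) yI unfolding I_def by auto
    moreover have "inj_on fst (insert (x, y) M)" "inj_on snd (insert (x, y) M)"
      using M'(2,3) x(2) ysnd by auto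
    ultimately have "insert (x, y) M \<in> \<R>"
      using M'(1) x(1) y(1) indep eq unfolding \<R>_def by auto
    then have "insert (x, y) M = M"
      using M(2) by blast
    then have "(x, y) \<in> M"
      by blast
    then show False
      using x(2) by force
  qed
  then have "|X| \<le>o |fst ` M|"
    by (rule card_of_mono1)
  also have "|fst ` M| \<le>o |M|"
    by (rule card_of_image)
  also have "|M| \<le>o |Y|"
    using M'(1,3) by (intro card_of_ordLeqI[of snd]) auto
  finally show ?thesis .
qed

section \<open>Dimension of subalgebras\<close>

lemma subalgebra_generated: "X \<subseteq> A \<Longrightarrow> subalgebra A F (gen X)"
  unfolding subalgebra_def by (simp add: gen_subset generated_closed)

lemma basis_ofD:
  assumes "basis_of F C X"
  shows "X \<subseteq> C" "independent_set F X" "gen X = C"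
  using assms unfolding basis_of_def by auto

text \<open>Extending the empty set inside \<open>C\<close> yields some basis, so the choice in
  \<open>dimension\<close> really picks one, and that one is returned.\<close>

lemma subalgebra_basis:
  assumes "subalgebra A F C"
  obtains X where "basis_of F C X" "dimension F C = |X|"
proof -
  have C: "C \<subseteq> A" "closed_under C F"
    using assms unfolding subalgebra_def by auto
  have "independent_set F {}"
    unfolding independent_set_def by simp
  from independent_extend[OF this empty_subsetI C(1)]
  obtain Z where "Z \<subseteq> C" "independent_set F Z" "gen Z = gen C"
    by metis
  then have "basis_of F C Z"
    unfolding basis_of_def using generated_id[OF C(2)] by simp
  then have "basis_of F C (SOME X. basis_of F C X)"
    by (rule someI)
  with that show thesis
    unfolding dimension_def by simp
qed

lemma dimension_le_card:
  assumes "subalgebra A F C" "C \<subseteq> gen Y" "Y \<subseteq> A"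
  shows "dimension F C \<le>o |Y|"
proof -
  obtain X where X: "basis_of F C X" "dimension F C = |X|"
    using subalgebra_basis[OF assms(1)] .
  then have "X \<subseteq> gen Y"
    using basis_ofD(1)[OF X(1)] assms(2) by simp
  then show ?thesis
    unfolding X(2) using basis_ofD(2)[OF X(1)] assms(3) by (intro independent_card_le)
qed

lemma card_le_dimension:
  assumes "subalgebra A F C" "independent_set F X" "X \<subseteq> C"
  shows "|X| \<le>o dimension F C"
proof -
  obtain Y where Y: "basis_of F C Y" "dimension F C = |Y|"
    using subalgebra_basis[OF assms(1)] .
  moreover have "Y \<subseteq> A"
    using basis_ofD(1)[OF Y(1)] assms(1) unfolding subalgebra_def by auto
  ultimately show ?thesis
    using assms(2,3) basis_ofD(3)[OF Y(1)] by (simp add: independent_card_le)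
qed

lemma dimension_basis:
  assumes "subalgebra A F C" "basis_of F C X"
  shows "|X| =o dimension F C"
proof -
  have "X \<subseteq> A"
    using basis_ofD(1)[OF assms(2)] assms(1) unfolding subalgebra_def by auto
  then show ?thesis
    using assms basis_ofD[OF assms(2)]
    by (simp add: ordIso_iff_ordLeq card_le_dimension dimension_le_card)
qed

lemma dimension_mono:
  assumes "subalgebra A F C" "subalgebra A F D" "C \<subseteq> D"
  shows "dimension F C \<le>o dimension F D"
proof -
  obtain X where X: "basis_of F C X" "dimension F C = |X|"
    using subalgebra_basis[OF assms(1)] .
  then show ?thesis
    using card_le_dimension[OF assms(2)] basis_ofD[OF X(1)] assms(3) by simp
qed

lemma dimension_total:
  assumes "subalgebra A F C" "subalgebra A F D"
  shows "dimension F C \<le>o dimension F D \<or> dimension F D \<le>o dimension F C"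
  unfolding dimension_def by (intro ordLeq_total card_of_Well_order)


subsection \<open>Endomorphisms\<close>

lemma endomorphismD:
  assumes "\<theta> \<in> endomorphisms A F"
  shows "\<theta> \<in> A \<rightarrow>\<^sub>E A"
    and "(n, f) \<in> F \<Longrightarrow> length xs = n \<Longrightarrow> set xs \<subseteq> A \<Longrightarrow> \<theta> (f xs) = f (map \<theta> xs)"
  using assms unfolding endomorphisms_def by auto

text \<open>The preimage of the right-hand side and the image of \<open>gen X\<close> are both
  closed under \<open>F\<close>, the latter by lifting argument lists to preimages.\<close>

lemma endomorphism_gen:
  assumes \<theta>: "\<theta> \<in> endomorphisms A F" and X: "X \<subseteq> A"
  shows "\<theta> ` gen X = gen (\<theta> ` X)"
proof
  have "gen X \<subseteq> {x \<in> A. \<theta> x \<in> gen (\<theta> ` X)}"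
  proof (rule generated_least)
    show "X \<subseteq> {x \<in> A. \<theta> x \<in> gen (\<theta> ` X)}"
      using X by (auto intro: generated_base)
    show "closed_under {x \<in> A. \<theta> x \<in> gen (\<theta> ` X)} F"
      unfolding closed_under_def
    proof safe
      fix f and xs :: "'a list"
      assume f: "(length xs, f) \<in> F" and xs: "set xs \<subseteq> {x \<in> A. \<theta> x \<in> gen (\<theta> ` X)}"
      then have xsA: "set xs \<subseteq> A"
        by auto
      then show "f xs \<in> A"
        using f A_closed unfolding closed_under_def by blast
      have "set (map \<theta> xs) \<subseteq> gen (\<theta> ` X)"
        using xs by auto
      then have "f (map \<theta> xs) \<in> gen (\<theta> ` X)"
        using f generated_closed[of F "\<theta> ` X"] unfolding closed_under_def by auto
      then show "\<theta> (f xs) \<in> gen (\<theta> ` X)"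
        using endomorphismD(2)[OF \<theta> f refl xsA] by simp
    qed
  qed
  then show "\<theta> ` gen X \<subseteq> gen (\<theta> ` X)"
    by auto
  show "gen (\<theta> ` X) \<subseteq> \<theta> ` gen X"
  proof (rule generated_least)
    show "\<theta> ` X \<subseteq> \<theta> ` gen X"
      by (intro image_mono generated_superset)
    show "closed_under (\<theta> ` gen X) F"
      unfolding closed_under_def
    proof safe
      fix f and ys :: "'a list"
      assume f: "(length ys, f) \<in> F" and "set ys \<subseteq> \<theta> ` gen X"
      then have "ys \<in> lists (\<theta> ` gen X)"
        by auto
      then obtain xs where xs: "ys = map \<theta> xs" "set xs \<subseteq> gen X"
        unfolding lists_image by auto
      have f': "(length xs, f) \<in> F"
        using f xs(1) by simp
      have "\<theta> (f xs) = f ys"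
        using endomorphismD(2)[OF \<theta> f' refl] xs gen_subset[OF X] by simp
      moreover have "f xs \<in> gen X"
        using f' xs(2) generated_closed[of F X] unfolding closed_under_def by auto
      ultimately show "f ys \<in> \<theta> ` gen X"
        by (metis imageI)
    qed
  qed
qed

lemma endomorphism_subalgebra:
  assumes "\<theta> \<in> endomorphisms A F" "subalgebra A F C"
  shows "subalgebra A F (\<theta> ` C)"
proof -
  have C: "C \<subseteq> A" "gen C = C"
    using assms(2) generated_id unfolding subalgebra_def by auto
  have "\<theta> ` C \<subseteq> A"
    using C(1) endomorphismD(1)[OF assms(1)] by auto
  then show ?thesis
    using subalgebra_generated endomorphism_gen[OF assms(1) C(1)] C(2) by metis
qed

text \<open>The set where two endomorphisms agree is closed under the operations.\<close>

lemma endomorphism_eq_gen: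
  assumes \<theta>: "\<theta> \<in> endomorphisms A F" "\<phi> \<in> endomorphisms A F"
    and X: "X \<subseteq> A" "\<And>x. x \<in> X \<Longrightarrow> \<theta> x = \<phi> x" and x: "x \<in> gen X"
  shows "\<theta> x = \<phi> x"
proof -
  have "gen X \<subseteq> {x \<in> A. \<theta> x = \<phi> x}"
  proof (rule generated_least)
    show "X \<subseteq> {x \<in> A. \<theta> x = \<phi> x}"
      using X by auto
    show "closed_under {x \<in> A. \<theta> x = \<phi> x} F"
      unfolding closed_under_def
    proof safe
      fix f and xs :: "'a list"
      assume f: "(length xs, f) \<in> F" and xs: "set xs \<subseteq> {x \<in> A. \<theta> x = \<phi> x}"
      then have xsA: "set xs \<subseteq> A"
        by auto
      then show "f xs \<in> A"
        using f A_closed unfolding closed_under_def by blast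
      have "map \<theta> xs = map \<phi> xs"
        using xs by auto
      then show "\<theta> (f xs) = \<phi> (f xs)"
        using endomorphismD(2)[OF \<theta>(1) f refl xsA] endomorphismD(2)[OF \<theta>(2) f refl xsA]
        by (simp del: map_eq_conv)
    qed
  qed
  with x show ?thesis by auto
qed

text \<open>Compared through \<open>endomorphism_eq_gen\<close> with other endomorphisms, it shows
  that they fix a subalgebra once they fix generators of it.\<close>

lemma identity_endomorphism: "(\<lambda>x\<in>A. x) \<in> endomorphisms A F"
proof -
  have "f xs \<in> A \<and> map (\<lambda>x\<in>A. x) xs = xs" if "(length xs, f) \<in> F" "set xs \<subseteq> A" for f xs
    using that A_closed unfolding closed_under_def by (auto intro!: map_idI)
  then show ?thesis
    unfolding endomorphisms_def by auto
qed

lemma map_mult_apply: "x \<in> A \<Longrightarrow> map_mult A \<alpha> \<beta> x = \<beta> (\<alpha> x)"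
  unfolding map_mult_def by (simp add: compose_def)

lemma map_mult_endomorphism:
  assumes "\<alpha> \<in> endomorphisms A F" "\<beta> \<in> endomorphisms A F"
  shows "map_mult A \<alpha> \<beta> \<in> endomorphisms A F"
proof -
  note A = endomorphismD(1)[OF assms(1)] endomorphismD(1)[OF assms(2)]
  have "map_mult A \<alpha> \<beta> \<in> A \<rightarrow>\<^sub>E A"
    using A unfolding map_mult_def compose_def by auto
  moreover have "map_mult A \<alpha> \<beta> (f xs) = f (map (map_mult A \<alpha> \<beta>) xs)"
    if f: "(length xs, f) \<in> F" "set xs \<subseteq> A" for f xs
  proof -
    have "f xs \<in> A"
      using f A_closed unfolding closed_under_def by blast
    moreover have "map (map_mult A \<alpha> \<beta>) xs = map \<beta> (map \<alpha> xs)"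
      using f(2) by (auto simp: map_mult_apply)
    moreover have "set (map \<alpha> xs) \<subseteq> A"
      using f(2) A(1) by auto
    ultimately show ?thesis
      using f endomorphismD(2)[OF assms(1) f(1) refl f(2)]
        endomorphismD(2)[OF assms(2), of "length xs" f "map \<alpha> xs"]
      by (simp add: map_mult_apply del: map_map map_eq_conv)
  qed
  ultimately show ?thesis
    unfolding endomorphisms_def by auto
qed

end


subsection \<open>Endomorphisms with restricted range\<close>

text \<open>The action on points of an element of \<open>S\<^sup>1\<close>, with \<open>None\<close>
  as the adjoined identity.\<close>

definition act :: "('a \<Rightarrow> 'a) option \<Rightarrow> 'a \<Rightarrow> 'a" where
  "act x v = (case x of None \<Rightarrow> v | Some \<alpha> \<Rightarrow> \<alpha> v)"

lemma act_simps [simp]: "act None v = v" "act (Some \<alpha>) v = \<alpha> v"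
  unfolding act_def by simp_all

text \<open>\<open>B_nontrivial\<close> is what the dimension hypothesis supplies: two values by
  which maps into \<open>B\<close> can be told apart.\<close>

locale restricted_range = indep_algebra +
  fixes B :: "'a set"
  assumes subalgebra_B: "subalgebra A F B" and B_proper: "B \<noteq> A"
    and B_nontrivial: "\<exists>b \<in> B. \<exists>c \<in> B. b \<noteq> c"
begin

abbreviation T :: "('a \<Rightarrow> 'a) set" where "T \<equiv> T_sgp A F B"
abbreviation mul :: "('a \<Rightarrow> 'a) \<Rightarrow> ('a \<Rightarrow> 'a) \<Rightarrow> 'a \<Rightarrow> 'a" where "mul \<equiv> map_mult A"
abbreviation rank :: "('a \<Rightarrow> 'a) \<Rightarrow> 'a rel" where "rank \<alpha> \<equiv> dimension F (\<alpha> ` A)"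

lemma B_subset: "B \<subseteq> A"
  using subalgebra_B unfolding subalgebra_def by blast

lemma gen_B: "X \<subseteq> B \<Longrightarrow> gen X \<subseteq> B"
  using subalgebra_B unfolding subalgebra_def by (simp add: generated_least)

lemma T_endo: "\<alpha> \<in> T \<Longrightarrow> \<alpha> \<in> endomorphisms A F"
  unfolding T_sgp_def by simp

lemma T_range: "\<alpha> \<in> T \<Longrightarrow> v \<in> A \<Longrightarrow> \<alpha> v \<in> B"
  unfolding T_sgp_def by auto

lemma T_restrict: "\<alpha> \<in> T \<Longrightarrow> restrict \<alpha> A = \<alpha>"
  by (rule PiE_restrict[OF endomorphismD(1)[OF T_endo]])

lemma T_gen: "\<alpha> \<in> T \<Longrightarrow> X \<subseteq> A \<Longrightarrow> \<alpha> ` gen X = gen (\<alpha> ` X)"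
  by (rule endomorphism_gen[OF T_endo])

lemma T_eq_gen:
  assumes "\<alpha> \<in> T" "\<beta> \<in> T" "X \<subseteq> A" "\<And>x. x \<in> X \<Longrightarrow> \<alpha> x = \<beta> x" "x \<in> gen X"
  shows "\<alpha> x = \<beta> x"
  by (rule endomorphism_eq_gen[OF T_endo[OF assms(1)] T_endo[OF assms(2)] assms(3-5)])

lemma subalgebra_A: "subalgebra A F A"
  unfolding subalgebra_def by (simp add: A_closed)

lemma T_subalgebra: "\<alpha> \<in> T \<Longrightarrow> subalgebra A F C \<Longrightarrow> subalgebra A F (\<alpha> ` C)"
  by (rule endomorphism_subalgebra[OF T_endo])

lemma T_image_subset: "\<alpha> \<in> T \<Longrightarrow> C \<subseteq> A \<Longrightarrow> \<alpha> ` C \<subseteq> B"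
  using T_range by blast

lemma mul_T: "\<alpha> \<in> T \<Longrightarrow> \<beta> \<in> T \<Longrightarrow> mul \<alpha> \<beta> \<in> T"
  using map_mult_endomorphism[OF T_endo T_endo, of \<alpha> \<beta>] T_range[of \<beta> "\<alpha> _"] T_range[of \<alpha>] B_subset
  by (auto simp: map_mult_apply T_sgp_def)

lemma mul_image: "mul \<alpha> \<beta> ` A = \<beta> ` \<alpha> ` A"
  by (auto simp: map_mult_apply image_iff)

text \<open>Extend \<open>X\<close> to a basis of \<open>A\<close> and send the new basis points to
  an arbitrary \<open>b\<close> of \<open>B\<close>. The image of the resulting endomorphism is
  generated by points of \<open>B\<close>.\<close>

lemma T_extension:
  assumes X: "independent_set F X" "X \<subseteq> A" and g: "g ` X \<subseteq> B"
  shows "\<exists>\<theta>\<in>T. \<forall>x\<in>X. \<theta> x = g x"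
proof -
  obtain Z where Z: "X \<subseteq> Z" "Z \<subseteq> A" "independent_set F Z" "gen Z = gen A"
    using independent_extend[OF X order_refl] by metis
  have gen_Z: "gen Z = A"
    using Z(4) generated_id[OF A_closed] by simp
  obtain b where b: "b \<in> B"
    using B_nontrivial by blast
  define h where "h = (\<lambda>z. if z \<in> X then g z else b)"
  have h: "h ` Z \<subseteq> B"
    using g b unfolding h_def by auto
  then have "h \<in> Z \<rightarrow> A"
    using B_subset by auto
  moreover have "basis_of F A Z"
    unfolding basis_of_def using Z gen_Z by simp
  ultimately obtain \<theta> where \<theta>: "\<theta> \<in> endomorphisms A F" "\<And>z. z \<in> Z \<Longrightarrow> \<theta> z = h z"
    using indep_algebra unfolding independence_algebra_def free_basis_property_def by metis
  have "\<theta> ` A = gen (\<theta> ` Z)"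
    using endomorphism_gen[OF \<theta>(1) Z(2)] gen_Z by simp
  also have "\<theta> ` Z = h ` Z"
    using \<theta>(2) by (intro image_cong) simp_all
  finally have "\<theta> ` A \<subseteq> B"
    using gen_B[OF h] by simp
  then have "\<theta> \<in> T"
    using \<theta>(1) unfolding T_sgp_def by simp
  moreover have "\<theta> x = g x" if "x \<in> X" for x
    using \<theta>(2)[of x] Z(1) that unfolding h_def by auto
  ultimately show ?thesis
    by blast
qed

section \<open>The relations L* and R* on \<open>T\<close>\<close>

lemma with_one_subset: "with_one T mul \<subseteq> insert None (Some ` T)"
  unfolding with_one_def by auto

lemma Some_with_one: "\<alpha> \<in> T \<Longrightarrow> Some \<alpha> \<in> with_one T mul"
  unfolding with_one_def by auto

lemma act_A:
  assumes "x \<in> with_one T mul" "v \<in> A"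
  shows "act x v \<in> A"
  using assms with_one_subset T_range B_subset by (auto simp: subset_iff)

lemma restrict_eq_iff: "restrict f A = restrict g A \<longleftrightarrow> (\<forall>v\<in>A. f v = g v)"
  by (metis restrict_apply restrict_ext)

text \<open>Writing products as restrictions to \<open>A\<close> turns their equality into equality
  at each point of \<open>A\<close>; for \<open>None\<close> this works because \<alpha> is itself
  extensional.\<close>

lemma mult_one_right:
  assumes "x \<in> with_one T mul" "\<alpha> \<in> T"
  shows "mult_one mul (Some \<alpha>) x = Some (\<lambda>v\<in>A. act x (\<alpha> v))"
  using assms T_restrict
  by (cases x) (simp_all add: map_mult_def compose_def)

lemma mult_one_left:
  assumes "x \<in> with_one T mul" "\<alpha> \<in> T"
  shows "mult_one mul x (Some \<alpha>) = Some (\<lambda>v\<in>A. \<alpha> (act x v))"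
  using assms T_restrict
  by (cases x) (simp_all add: map_mult_def compose_def)

text \<open>As products apply the left factor first, the test factors of L* act on values of
  \<alpha>, while those of R* act on its arguments.\<close>

lemma L_star_eq:
  "(\<alpha>, \<beta>) \<in> L_star T mul \<longleftrightarrow> \<alpha> \<in> T \<and> \<beta> \<in> T \<and>
    (\<forall>x \<in> with_one T mul. \<forall>y \<in> with_one T mul.
      (\<forall>v\<in>A. act x (\<alpha> v) = act y (\<alpha> v)) \<longleftrightarrow> (\<forall>v\<in>A. act x (\<beta> v) = act y (\<beta> v)))"
  unfolding L_star_def
  by (simp add: mult_one_right restrict_eq_iff cong: conj_cong ball_cong)

lemma R_star_eq:
  "(\<alpha>, \<beta>) \<in> R_star T mul \<longleftrightarrow> \<alpha> \<in> T \<and> \<beta> \<in> T \<and>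
    (\<forall>x \<in> with_one T mul. \<forall>y \<in> with_one T mul.
      (\<forall>v\<in>A. \<alpha> (act x v) = \<alpha> (act y v)) \<longleftrightarrow> (\<forall>v\<in>A. \<beta> (act x v) = \<beta> (act y v)))"
  unfolding R_star_def
  by (simp add: mult_one_left restrict_eq_iff cong: conj_cong ball_cong)

lemma L_starI:
  assumes "\<alpha> \<in> T" "\<beta> \<in> T" "\<alpha> ` A = \<beta> ` A"
  shows "(\<alpha>, \<beta>) \<in> L_star T mul"
proof -
  have "(\<forall>v\<in>A. P (\<alpha> v)) \<longleftrightarrow> (\<forall>v\<in>A. P (\<beta> v))" for P
  proof -
    have "(\<forall>v\<in>A. P (\<alpha> v)) \<longleftrightarrow> (\<forall>w\<in>\<alpha> ` A. P w)"
      by simp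
    also have "\<dots> \<longleftrightarrow> (\<forall>w\<in>\<beta> ` A. P w)"
      by (simp only: assms(3))
    also have "\<dots> \<longleftrightarrow> (\<forall>v\<in>A. P (\<beta> v))"
      by simp
    finally show ?thesis .
  qed
  then show ?thesis
    unfolding L_star_eq using assms(1,2) by (intro conjI ballI)
qed

text \<open>
  The point \<open>w\<close> together with a basis of \<open>C\<close> is independent, and \<open>B\<close> has two elements.
\<close>

lemma separating_maps:
  assumes C: "subalgebra A F C" and w: "w \<in> A" "w \<notin> C"
  obtains \<xi> \<eta> where "\<xi> \<in> T" "\<eta> \<in> T" "\<And>v. v \<in> C \<Longrightarrow> \<xi> v = \<eta> v" "\<xi> w \<noteq> \<eta> w"
proof -
  obtain X where X: "basis_of F C X"
    using subalgebra_basis[OF C] by metis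
  note X' = basis_ofD[OF X]
  have XA: "X \<subseteq> A"
    using X'(1) C unfolding subalgebra_def by auto
  have indep: "independent_set F (insert w X)"
    using independent_insert[OF X'(2) XA w(1)] X'(3) w(2) by simp
  obtain b c where bc: "b \<in> B" "c \<in> B" "b \<noteq> c"
    using B_nontrivial by blast
  have sub: "insert w X \<subseteq> A"
    using XA w(1) by simp
  \<comment> \<open>\<xi> is constantly \<open>b\<close> on the independent set, and \<eta> differs
    from it there only at \<open>w\<close>.\<close>
  obtain \<xi> where \<xi>: "\<xi> \<in> T" "\<And>v. v \<in> insert w X \<Longrightarrow> \<xi> v = b"
    using T_extension[OF indep sub, of "\<lambda>_. b"] bc(1) by auto
  have "(\<lambda>v. if v = w then c else b) ` insert w X \<subseteq> B"
    using bc(1,2) by auto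
  from T_extension[OF indep sub this]
  obtain \<eta> where \<eta>: "\<eta> \<in> T" "\<And>v. v \<in> insert w X \<Longrightarrow> \<eta> v = (if v = w then c else b)"
    by blast
  have "w \<notin> X"
    using X'(1) w(2) by blast
  have "\<xi> v = \<eta> v" if "v \<in> C" for v
  proof (rule T_eq_gen[OF \<xi>(1) \<eta>(1) XA])
    show "\<xi> x = \<eta> x" if "x \<in> X" for x
      using \<xi>(2)[of x] \<eta>(2)[of x] \<open>w \<notin> X\<close> that by auto
  qed (simp add: X'(3) that)
  moreover have "\<xi> w \<noteq> \<eta> w"
    using \<xi>(2)[of w] \<eta>(2)[of w] bc(3) by simp
  ultimately show thesis
    using \<xi>(1) \<eta>(1) that by metis
qed

text \<open>A value of \<beta> outside the image of \<alpha> would be separated by two maps that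
  agree on that image, which L* forbids.\<close>

lemma L_star_image:
  assumes "(\<alpha>, \<beta>) \<in> L_star T mul"
  shows "\<alpha> ` A = \<beta> ` A"
proof -
  have "\<beta> ` A \<subseteq> \<alpha> ` A" if ab: "(\<alpha>, \<beta>) \<in> L_star T mul" for \<alpha> \<beta>
  proof (rule ccontr)
    have T: "\<alpha> \<in> T" "\<beta> \<in> T"
      using ab unfolding L_star_def by auto
    assume "\<not> \<beta> ` A \<subseteq> \<alpha> ` A"
    then obtain u where u: "u \<in> A" "\<beta> u \<notin> \<alpha> ` A"
      by blast
    have "\<beta> u \<in> A"
      using T_range[OF T(2) u(1)] B_subset by blast
    then obtain \<xi> \<eta> where \<xi>\<eta>: "\<xi> \<in> T" "\<eta> \<in> T" "\<And>v. v \<in> \<alpha> ` A \<Longrightarrow> \<xi> v = \<eta> v" "\<xi> (\<beta> u) \<noteq> \<eta> (\<beta> u)"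
      using separating_maps[OF T_subalgebra[OF T(1) subalgebra_A]] u(2) by metis
    have "(\<forall>v\<in>A. \<xi> (\<alpha> v) = \<eta> (\<alpha> v)) \<longleftrightarrow> (\<forall>v\<in>A. \<xi> (\<beta> v) = \<eta> (\<beta> v))"
      using ab Some_with_one[OF \<xi>\<eta>(1)] Some_with_one[OF \<xi>\<eta>(2)] unfolding L_star_eq
      by (metis act_simps(2))
    then show False
      using \<xi>\<eta>(3,4) u(1) by blast
  qed
  moreover have "(\<beta>, \<alpha>) \<in> L_star T mul"
    using assms equiv_L_star by (meson equivE symD)
  ultimately show ?thesis
    using assms by blast
qed

text \<open>\<open>None\<close> is available only when \<open>T\<close> has no identity. In either
  case some \<open>u\<close> acts trivially before every map of \<open>T\<close>, so a left identity
  law can be tested by R*.\<close>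

lemma local_identity:
  obtains u where "u \<in> with_one T mul" "\<And>\<alpha> v. \<alpha> \<in> T \<Longrightarrow> v \<in> A \<Longrightarrow> \<alpha> (act u v) = \<alpha> v"
proof (cases "\<exists>e \<in> T. \<forall>\<alpha> \<in> T. mul e \<alpha> = \<alpha> \<and> mul \<alpha> e = \<alpha>")
  case True
  then obtain e where e: "e \<in> T" "\<And>\<alpha>. \<alpha> \<in> T \<Longrightarrow> mul e \<alpha> = \<alpha>"
    by blast
  have "\<alpha> (act (Some e) v) = \<alpha> v" if "\<alpha> \<in> T" "v \<in> A" for \<alpha> v
    using map_mult_apply[OF that(2), of e \<alpha>] e(2)[OF that(1)] by simp
  with Some_with_one[OF e(1)] show thesis
    by (rule that)
next
  case False
  then have "None \<in> with_one T mul"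
    unfolding with_one_def by simp
  then show thesis
    by (rule that) simp
qed

lemma R_starD:
  assumes "(\<alpha>, \<beta>) \<in> R_star T mul" "x \<in> with_one T mul" "y \<in> with_one T mul"
  shows "(\<forall>v\<in>A. \<alpha> (act x v) = \<alpha> (act y v)) \<longleftrightarrow> (\<forall>v\<in>A. \<beta> (act x v) = \<beta> (act y v))"
  using assms unfolding R_star_eq by simp

lemma R_star_sym: "(\<alpha>, \<beta>) \<in> R_star T mul \<Longrightarrow> (\<beta>, \<alpha>) \<in> R_star T mul"
  using equiv_R_star by (meson equivE symD)

lemma R_star_T: "(\<alpha>, \<beta>) \<in> R_star T mul \<Longrightarrow> \<alpha> \<in> T \<and> \<beta> \<in> T"
  unfolding R_star_def by simp

lemma A_basis:
  obtains Z where "basis_of F A Z" "Z \<noteq> {}"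
proof -
  obtain Z where Z: "basis_of F A Z"
    using subalgebra_basis[OF subalgebra_A] by metis
  have "Z \<noteq> {}"
  proof
    assume "Z = {}"
    then have "A \<subseteq> B"
      using gen_B[of "{}"] basis_ofD(3)[OF Z] by simp
    then show False
      using B_subset B_proper by simp
  qed
  with Z show thesis
    by (rule that)
qed

text \<open>The test maps send a whole non-empty basis of \<open>A\<close> to \<open>b\<close> and
  to \<open>c\<close>; followed by a map \<gamma> of \<open>T\<close> they agree exactly when
  \<gamma> identifies \<open>b\<close> and \<open>c\<close>.\<close>

lemma R_star_kernel:
  assumes R: "(\<alpha>, \<beta>) \<in> R_star T mul" and bc: "b \<in> B" "c \<in> B"
  shows "\<alpha> b = \<alpha> c \<longleftrightarrow> \<beta> b = \<beta> c"
proof -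
  obtain Z where Z: "basis_of F A Z" "Z \<noteq> {}"
    by (rule A_basis)
  note Z' = basis_ofD[OF Z(1)]
  obtain \<xi> where \<xi>: "\<xi> \<in> T" "\<And>z. z \<in> Z \<Longrightarrow> \<xi> z = b"
    using T_extension[OF Z'(2,1), of "\<lambda>_. b"] bc(1) by auto
  obtain \<eta> where \<eta>: "\<eta> \<in> T" "\<And>z. z \<in> Z \<Longrightarrow> \<eta> z = c"
    using T_extension[OF Z'(2,1), of "\<lambda>_. c"] bc(2) by auto
  have iff: "(\<forall>v\<in>A. \<gamma> (\<xi> v) = \<gamma> (\<eta> v)) \<longleftrightarrow> \<gamma> b = \<gamma> c" if \<gamma>: "\<gamma> \<in> T" for \<gamma>
  proof
    assume "\<forall>v\<in>A. \<gamma> (\<xi> v) = \<gamma> (\<eta> v)"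
    then show "\<gamma> b = \<gamma> c"
      using Z(2) Z'(1) \<xi>(2) \<eta>(2) by (metis ex_in_conv subsetD)
  next
    assume eq: "\<gamma> b = \<gamma> c"
    have "mul \<xi> \<gamma> v = mul \<eta> \<gamma> v" if "v \<in> A" for v
    proof (rule T_eq_gen[OF mul_T[OF \<xi>(1) \<gamma>] mul_T[OF \<eta>(1) \<gamma>] Z'(1)])
      show "mul \<xi> \<gamma> z = mul \<eta> \<gamma> z" if "z \<in> Z" for z
        using that Z'(1) \<xi>(2) \<eta>(2) eq by (simp add: map_mult_apply subset_iff)
    qed (simp add: Z'(3) that)
    then show "\<forall>v\<in>A. \<gamma> (\<xi> v) = \<gamma> (\<eta> v)"
      by (simp add: map_mult_apply)
  qed
  have "(\<forall>v\<in>A. \<alpha> (\<xi> v) = \<alpha> (\<eta> v)) \<longleftrightarrow> (\<forall>v\<in>A. \<beta> (\<xi> v) = \<beta> (\<eta> v))"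
    using R_starD[OF R Some_with_one[OF \<xi>(1)] Some_with_one[OF \<eta>(1)]] by simp
  then show ?thesis
    using iff R_star_T[OF R] by simp
qed

text \<open>
  The maps \<open>\<alpha>\<close> with \<open>\<alpha> ` B = \<alpha> ` A\<close> are the regular elements of \<open>T\<close>; they are exactly those
  with a left identity in \<open>T\<close>, which is why \<open>\<R>\<^sup>*\<close> separates them from the other elements.
\<close>

lemma R_star_regular:
  assumes R: "(\<alpha>, \<beta>) \<in> R_star T mul" and reg: "\<alpha> ` B = \<alpha> ` A"
  obtains \<eta> where "\<eta> \<in> T" "\<And>v. v \<in> A \<Longrightarrow> \<alpha> (\<eta> v) = \<alpha> v" "\<And>v. v \<in> A \<Longrightarrow> \<beta> (\<eta> v) = \<beta> v"
proof -
  have T: "\<alpha> \<in> T" "\<beta> \<in> T"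
    using R_star_T[OF R] by auto
  obtain Z where Z: "basis_of F A Z"
    using subalgebra_basis[OF subalgebra_A] by metis
  note Z' = basis_ofD[OF Z]
  \<comment> \<open>Regularity gives each basis point a companion in \<open>B\<close> with the same
    value under \<alpha>. Moving the basis there yields a left identity \<eta> of \<alpha>.\<close>
  have "\<exists>b. b \<in> B \<and> \<alpha> b = \<alpha> z" if "z \<in> Z" for z
  proof -
    have "\<alpha> z \<in> \<alpha> ` B"
      using that Z'(1) reg by auto
    then show ?thesis
      by (metis imageE)
  qed
  then obtain h where h: "\<And>z. z \<in> Z \<Longrightarrow> h z \<in> B" "\<And>z. z \<in> Z \<Longrightarrow> \<alpha> (h z) = \<alpha> z"
    by metis
  obtain \<eta> where \<eta>: "\<eta> \<in> T" "\<And>z. z \<in> Z \<Longrightarrow> \<eta> z = h z"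
    using T_extension[OF Z'(2,1), of h] h(1) by blast
  have "mul \<eta> \<alpha> v = \<alpha> v" if "v \<in> A" for v
  proof (rule T_eq_gen[OF mul_T[OF \<eta>(1) T(1)] T(1) Z'(1)])
    show "mul \<eta> \<alpha> z = \<alpha> z" if "z \<in> Z" for z
      using that Z'(1) \<eta>(2) h(2) by (simp add: map_mult_apply subset_iff)
  qed (simp add: Z'(3) that)
  then have \<alpha>: "\<alpha> (\<eta> v) = \<alpha> v" if "v \<in> A" for v
    using that by (simp add: map_mult_apply)
  \<comment> \<open>Comparing \<eta> with \<open>u\<close> makes the left identity law an instance
    of the R* condition, so it passes to \<beta>.\<close>
  obtain u where u: "u \<in> with_one T mul" "\<And>\<gamma> v. \<gamma> \<in> T \<Longrightarrow> v \<in> A \<Longrightarrow> \<gamma> (act u v) = \<gamma> v"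
    using local_identity by metis
  have "(\<forall>v\<in>A. \<alpha> (\<eta> v) = \<alpha> (act u v)) \<longleftrightarrow> (\<forall>v\<in>A. \<beta> (\<eta> v) = \<beta> (act u v))"
    using R_starD[OF R Some_with_one[OF \<eta>(1)] u(1)] by simp
  then have "\<beta> (\<eta> v) = \<beta> v" if "v \<in> A" for v
    using that \<alpha> u(2)[OF T(1)] u(2)[OF T(2)] by simp
  with \<eta>(1) \<alpha> show thesis
    by (rule that)
qed

lemma R_star_regular_image:
  assumes "(\<alpha>, \<beta>) \<in> R_star T mul" "\<alpha> ` B = \<alpha> ` A"
  shows "\<beta> ` B = \<beta> ` A"
proof -
  obtain \<eta> where \<eta>: "\<eta> \<in> T" "\<And>v. v \<in> A \<Longrightarrow> \<beta> (\<eta> v) = \<beta> v"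
    using R_star_regular[OF assms] by metis
  have "\<beta> v \<in> \<beta> ` B" if "v \<in> A" for v
    using \<eta>(2)[OF that] T_range[OF \<eta>(1) that] by (metis imageI)
  then show ?thesis
    using B_subset by blast
qed

text \<open>The common left identity \<eta> moves both points into \<open>B\<close> without changing
  their values, and there \<open>R_star_kernel\<close> applies.\<close>

lemma R_star_regular_kernel:
  assumes R: "(\<alpha>, \<beta>) \<in> R_star T mul" and reg: "\<alpha> ` B = \<alpha> ` A" and uv: "u \<in> A" "v \<in> A"
  shows "\<alpha> u = \<alpha> v \<longleftrightarrow> \<beta> u = \<beta> v"
proof -
  obtain \<eta> where \<eta>: "\<eta> \<in> T" "\<And>v. v \<in> A \<Longrightarrow> \<alpha> (\<eta> v) = \<alpha> v" "\<And>v. v \<in> A \<Longrightarrow> \<beta> (\<eta> v) = \<beta> v"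
    using R_star_regular[OF R reg] by metis
  show ?thesis
    using R_star_kernel[OF R T_range[OF \<eta>(1) uv(1)] T_range[OF \<eta>(1) uv(2)]]
    by (simp add: \<eta>(2,3) uv)
qed

lemma R_starI_kernel:
  assumes "\<alpha> \<in> T" "\<beta> \<in> T" "\<And>u v. u \<in> A \<Longrightarrow> v \<in> A \<Longrightarrow> \<alpha> u = \<alpha> v \<longleftrightarrow> \<beta> u = \<beta> v"
  shows "(\<alpha>, \<beta>) \<in> R_star T mul"
  unfolding R_star_eq using assms(1,2)
  by (intro conjI ballI) (auto simp: assms(3) act_A)

text \<open>Two test factors from \<open>T\<close> have values in \<open>B\<close>, where the
  kernels agree. A factor from \<open>T\<close> tested against the adjoined identity would have to
  be a left identity, which neither map has.\<close>

lemma R_starI_nonregular: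
  assumes T: "\<alpha> \<in> T" "\<beta> \<in> T" and nonreg: "\<alpha> ` B \<noteq> \<alpha> ` A" "\<beta> ` B \<noteq> \<beta> ` A"
    and ker: "\<And>b c. b \<in> B \<Longrightarrow> c \<in> B \<Longrightarrow> \<alpha> b = \<alpha> c \<longleftrightarrow> \<beta> b = \<beta> c"
  shows "(\<alpha>, \<beta>) \<in> R_star T mul"
proof -
  have no_left_identity: "\<not> (\<forall>v\<in>A. \<gamma> (\<eta> v) = \<gamma> v)" if "\<eta> \<in> T" "\<gamma> ` B \<noteq> \<gamma> ` A" for \<eta> \<gamma>
  proof
    assume "\<forall>v\<in>A. \<gamma> (\<eta> v) = \<gamma> v"
    then have "\<gamma> ` A \<subseteq> \<gamma> ` B"
      using T_range[OF that(1)] by (metis image_eqI image_subsetI)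
    then show False
      using that(2) B_subset by blast
  qed
  have "(\<forall>v\<in>A. \<alpha> (act x v) = \<alpha> (act y v)) \<longleftrightarrow> (\<forall>v\<in>A. \<beta> (act x v) = \<beta> (act y v))"
    if x: "x \<in> insert None (Some ` T)" and y: "y \<in> insert None (Some ` T)" for x y
  proof (cases x; cases y)
    fix \<xi> assume xy: "x = Some \<xi>" "y = None"
    then have "\<xi> \<in> T"
      using x by auto
    then show ?thesis
      unfolding xy act_simps
      using no_left_identity[OF _ nonreg(1)] no_left_identity[OF _ nonreg(2)] by blast
  next
    fix \<eta> assume xy: "x = None" "y = Some \<eta>"
    then have "\<eta> \<in> T"
      using y by auto
    then have "\<not> (\<forall>v\<in>A. \<alpha> v = \<alpha> (\<eta> v))" "\<not> (\<forall>v\<in>A. \<beta> v = \<beta> (\<eta> v))"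
      using no_left_identity[OF _ nonreg(1)] no_left_identity[OF _ nonreg(2)] by metis+
    then show ?thesis
      unfolding xy act_simps by blast
  next
    fix \<xi> \<eta> assume xy: "x = Some \<xi>" "y = Some \<eta>"
    then have "\<xi> \<in> T" "\<eta> \<in> T"
      using x y by auto
    with xy show ?thesis
      using ker T_range by (simp cong: ball_cong)
  qed simp
  then show ?thesis
    unfolding R_star_eq using T with_one_subset by (simp add: subset_iff)
qed

section \<open>Rank\<close>

text \<open>Lift a basis of the image under \<alpha> to \<open>P\<close>, one preimage per basis
  point. Each \<open>v\<close> in \<open>D\<close> has the same \<alpha>-value as some
  \<open>w\<close> in \<open>gen P\<close>, hence the same \<beta>-value, so the images of
  \<open>P\<close> under \<beta> generate the image of \<open>D\<close>.\<close>

lemma dimension_image_kernel: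
  assumes T: "\<alpha> \<in> T" "\<beta> \<in> T" and D: "subalgebra A F D"
    and ker: "\<And>u v. u \<in> D \<Longrightarrow> v \<in> D \<Longrightarrow> \<alpha> u = \<alpha> v \<Longrightarrow> \<beta> u = \<beta> v"
  shows "dimension F (\<beta> ` D) \<le>o dimension F (\<alpha> ` D)"
proof -
  have D': "D \<subseteq> A" "gen D = D"
    using D generated_id unfolding subalgebra_def by auto
  obtain X where X: "basis_of F (\<alpha> ` D) X" "dimension F (\<alpha> ` D) = |X|"
    using subalgebra_basis[OF T_subalgebra[OF T(1) D]] by metis
  obtain P where P: "P \<subseteq> D" "inj_on \<alpha> P" "X = \<alpha> ` P"
    using basis_ofD(1)[OF X(1)] unfolding subset_image_inj by metis
  have PA: "P \<subseteq> A"
    using P(1) D'(1) by simp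
  have genP: "gen P \<subseteq> D"
    using generated_mono[OF P(1)] D'(2) by metis
  have "\<beta> v \<in> gen (\<beta> ` P)" if v: "v \<in> D" for v
  proof -
    have "\<alpha> v \<in> \<alpha> ` gen P"
      using T_gen[OF T(1) PA] basis_ofD(3)[OF X(1)] P(3) v by simp
    then obtain w where w: "w \<in> gen P" "\<alpha> v = \<alpha> w"
      by (metis imageE)
    then have "\<beta> v = \<beta> w"
      using ker[of v w] v genP by blast
    then show ?thesis
      using T_gen[OF T(2) PA] w(1) by (metis imageI)
  qed
  moreover have "\<beta> ` P \<subseteq> A"
    using T_image_subset[OF T(2) PA] B_subset by simp
  ultimately have "dimension F (\<beta> ` D) \<le>o |\<beta> ` P|"
    by (intro dimension_le_card T_subalgebra T D) auto
  also have "|\<beta> ` P| \<le>o |P|"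
    by (rule card_of_image)
  also have "|P| =o |X|"
    using P(2,3) card_of_ordIso by (metis inj_on_imp_bij_betw)
  finally show ?thesis
    unfolding X(2) .
qed

text \<open>The product identifies all points that \<alpha> identifies, and its image lies in that
  of \<beta>.\<close>

lemma rank_mul_le:
  assumes "\<alpha> \<in> T" "\<beta> \<in> T"
  shows "rank (mul \<alpha> \<beta>) \<le>o rank \<alpha>" "rank (mul \<alpha> \<beta>) \<le>o rank \<beta>"
proof -
  show "rank (mul \<alpha> \<beta>) \<le>o rank \<alpha>"
    by (rule dimension_image_kernel[OF assms(1) mul_T[OF assms] subalgebra_A])
      (simp add: map_mult_apply)
  have "\<alpha> ` A \<subseteq> A"
    using T_image_subset[OF assms(1) order_refl] B_subset by simp
  then show "rank (mul \<alpha> \<beta>) \<le>o rank \<beta>"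
    unfolding mul_image
    by (intro dimension_mono T_subalgebra assms subalgebra_A image_mono)
qed

lemma rank_total: "\<alpha> \<in> T \<Longrightarrow> \<beta> \<in> T \<Longrightarrow> rank \<alpha> \<le>o rank \<beta> \<or> rank \<beta> \<le>o rank \<alpha>"
  by (intro dimension_total T_subalgebra subalgebra_A)

lemma rank_refl: "\<alpha> \<in> T \<Longrightarrow> rank \<alpha> \<le>o rank \<alpha>"
  using rank_total by blast

lemma D_star_sym: "(\<alpha>, \<beta>) \<in> D_star T mul \<Longrightarrow> (\<beta>, \<alpha>) \<in> D_star T mul"
  using equiv_D_star by (meson equivE symD)

lemma D_star_trans:
  "(\<alpha>, \<beta>) \<in> D_star T mul \<Longrightarrow> (\<beta>, \<gamma>) \<in> D_star T mul \<Longrightarrow> (\<alpha>, \<gamma>) \<in> D_star T mul"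
  using equiv_D_star by (meson equivE transD)

lemma D_star_T: "(\<alpha>, \<beta>) \<in> D_star T mul \<Longrightarrow> \<alpha> \<in> T \<and> \<beta> \<in> T"
  using equiv_D_star[of T mul] unfolding equiv_def by blast

text \<open>Let \<pi> carry a basis of the image of \<alpha> bijectively onto one of the image of
  \<beta>. Then \<open>mul \<alpha> \<pi>\<close> has the kernel of \<alpha> and the image of
  \<beta>, so it links the two by R* and L*.\<close>

lemma rank_eq_D_star:
  assumes T: "\<alpha> \<in> T" "\<beta> \<in> T" and le: "rank \<alpha> \<le>o rank \<beta>" "rank \<beta> \<le>o rank \<alpha>"
  shows "(\<alpha>, \<beta>) \<in> D_star T mul"
proof -
  obtain X where X: "basis_of F (\<alpha> ` A) X" "rank \<alpha> = |X|"
    using subalgebra_basis[OF T_subalgebra[OF T(1) subalgebra_A]] by metis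
  obtain Y where Y: "basis_of F (\<beta> ` A) Y" "rank \<beta> = |Y|"
    using subalgebra_basis[OF T_subalgebra[OF T(2) subalgebra_A]] by metis
  note X' = basis_ofD[OF X(1)] and Y' = basis_ofD[OF Y(1)]
  have XB: "X \<subseteq> B" and YB: "Y \<subseteq> B"
    using X'(1) Y'(1) T_image_subset[OF T(1) order_refl] T_image_subset[OF T(2) order_refl]
    by simp_all
  then have XA: "X \<subseteq> A" and YA: "Y \<subseteq> A"
    using B_subset by auto
  have "|X| =o |Y|"
    using le unfolding X(2) Y(2) by (simp add: ordIso_iff_ordLeq)
  then obtain h where h: "bij_betw h X Y"
    unfolding card_of_ordIso[symmetric] by blast
  have "h ` X \<subseteq> B"
    using h YB by (simp add: bij_betw_def)
  from T_extension[OF X'(2) XA this] obtain \<pi> where \<pi>: "\<pi> \<in> T" "\<And>x. x \<in> X \<Longrightarrow> \<pi> x = h x"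
    by blast
  \<comment> \<open>The map \<pi>' undoes \<pi> on the image of \<alpha>; this is how \<pi> is seen
    to be injective there.\<close>
  have "inv_into X h ` Y \<subseteq> B"
    using bij_betw_inv_into[OF h] XB by (simp add: bij_betw_def)
  from T_extension[OF Y'(2) YA this]
  obtain \<pi>' where \<pi>': "\<pi>' \<in> T" "\<And>y. y \<in> Y \<Longrightarrow> \<pi>' y = inv_into X h y"
    by blast
  have "\<pi> ` X = Y"
    using h \<pi>(2) by (simp add: bij_betw_def cong: image_cong)
  then have image: "mul \<alpha> \<pi> ` A = \<beta> ` A"
    unfolding mul_image using T_gen[OF \<pi>(1) XA] X'(3) Y'(3) by simp
  have inverse: "\<pi>' (\<pi> w) = w" if w: "w \<in> \<alpha> ` A" for w
  proof -
    have wA: "w \<in> A"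
      using w T_image_subset[OF T(1)] B_subset by blast
    have "mul \<pi> \<pi>' w = (\<lambda>x\<in>A. x) w"
    proof (rule endomorphism_eq_gen[OF T_endo[OF mul_T[OF \<pi>(1) \<pi>'(1)]] identity_endomorphism XA])
      show "mul \<pi> \<pi>' x = (\<lambda>x\<in>A. x) x" if x: "x \<in> X" for x
      proof -
        have "x \<in> A" "h x \<in> Y"
          using x XA h by (auto simp: bij_betw_def)
        then show ?thesis
          using \<pi>(2)[OF x] \<pi>'(2) bij_betw_inv_into_left[OF h x] by (simp add: map_mult_apply)
      qed
    qed (simp add: X'(3) w)
    then show ?thesis
      using wA by (simp add: map_mult_apply)
  qed
  have "(\<alpha>, mul \<alpha> \<pi>) \<in> R_star T mul"
  proof (rule R_starI_kernel[OF T(1) mul_T[OF T(1) \<pi>(1)]])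
    fix u v assume uv: "u \<in> A" "v \<in> A"
    then show "\<alpha> u = \<alpha> v \<longleftrightarrow> mul \<alpha> \<pi> u = mul \<alpha> \<pi> v"
      using inverse[of "\<alpha> u"] inverse[of "\<alpha> v"] by (metis imageI map_mult_apply)
  qed
  moreover have "(mul \<alpha> \<pi>, \<beta>) \<in> L_star T mul"
    using image by (intro L_starI mul_T T \<pi>)
  ultimately show ?thesis
    using R_star_subset_D_star L_star_subset_D_star D_star_trans by blast
qed

text \<open>
  For nonregular \<open>\<alpha>\<close> only the kernel on \<open>B\<close> is determined by the \<open>\<R>\<^sup>*\<close>-class. Composing
  \<open>\<gamma>\<close> with a projection that fixes \<open>\<gamma> ` B\<close> lowers the rank to any prescribed value in between
  while keeping that kernel.
\<close>

lemma R_star_convex: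
  assumes R: "(\<alpha>, \<gamma>) \<in> R_star T mul" and \<beta>: "\<beta> \<in> T"
    and le: "rank \<alpha> \<le>o rank \<beta>" "rank \<beta> \<le>o rank \<gamma>"
  shows "(\<alpha>, \<beta>) \<in> D_star T mul"
proof (cases "\<alpha> ` B = \<alpha> ` A")
  case True
  have T: "\<alpha> \<in> T" "\<gamma> \<in> T"
    using R_star_T[OF R] by auto
  \<comment> \<open>In the regular case the kernels agree on all of \<open>A\<close>, so the three
    ranks coincide.\<close>
  have "rank \<gamma> \<le>o rank \<alpha>"
    using R_star_regular_kernel[OF R True] by (intro dimension_image_kernel T subalgebra_A) simp
  then have "rank \<beta> \<le>o rank \<alpha>"
    using le(2) ordLeq_transitive by blast
  then show ?thesis
    using rank_eq_D_star[OF T(1) \<beta> le(1)] by simp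
next
  case False
  have T: "\<alpha> \<in> T" "\<gamma> \<in> T"
    using R_star_T[OF R] by auto
  have nonreg: "\<gamma> ` B \<noteq> \<gamma> ` A"
    using R_star_regular_image[OF R_star_sym[OF R]] False by blast
  have sub\<gamma>B: "subalgebra A F (\<gamma> ` B)" and sub\<gamma>A: "subalgebra A F (\<gamma> ` A)"
    using T_subalgebra[OF T(2)] subalgebra_B subalgebra_A by auto
  obtain M where M: "rank \<beta> = |M|"
    using subalgebra_basis[OF T_subalgebra[OF \<beta> subalgebra_A]] by metis
  obtain K where K: "basis_of F (\<gamma> ` B) K" "dimension F (\<gamma> ` B) = |K|"
    using subalgebra_basis[OF sub\<gamma>B] by metis
  note K' = basis_ofD[OF K(1)]
  have \<gamma>BA: "\<gamma> ` B \<subseteq> \<gamma> ` A" and \<gamma>A: "\<gamma> ` A \<subseteq> B"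
    using B_subset T_image_subset[OF T(2)] by auto
  \<comment> \<open>The common kernel on \<open>B\<close> bounds the size of \<open>K\<close> by the
    rank of \<alpha>, so \<open>K\<close> fits inside an independent set whose size is the rank of
    \<beta>.\<close>
  have "dimension F (\<gamma> ` B) \<le>o dimension F (\<alpha> ` B)"
    using R_star_kernel[OF R] by (intro dimension_image_kernel T subalgebra_B) simp
  also have "dimension F (\<alpha> ` B) \<le>o rank \<alpha>"
    using T_subalgebra[OF T(1)] subalgebra_B subalgebra_A B_subset
    by (intro dimension_mono image_mono)
  finally have K\<alpha>: "|K| \<le>o rank \<alpha>"
    unfolding K(2) .
  then have KM: "|K| \<le>o |M|"
    using le(1) M ordLeq_transitive by metis
  have "K \<subseteq> \<gamma> ` A" "\<gamma> ` A \<subseteq> A"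
    using K'(1) \<gamma>BA \<gamma>A B_subset by auto
  from independent_extend[OF K'(2) this]
  obtain X where X: "K \<subseteq> X" "X \<subseteq> \<gamma> ` A" "independent_set F X" "gen X = gen (\<gamma> ` A)"
    by metis
  have genX: "gen X = \<gamma> ` A"
    using X(4) sub\<gamma>A generated_id unfolding subalgebra_def by metis
  have "basis_of F (\<gamma> ` A) X"
    unfolding basis_of_def using X genX by simp
  from dimension_basis[OF sub\<gamma>A this] have "|M| \<le>o |X|"
    using le(2) unfolding M by (meson ordIso_symmetric ordLeq_ordIso_trans)
  from card_between[OF X(1) KM this]
  obtain L where L: "K \<subseteq> L" "L \<subseteq> X" "|L| =o |M|"
    by metis
  have XA: "X \<subseteq> A" and LA: "L \<subseteq> A" and LB: "L \<subseteq> B"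
    using X(2) L(2) \<gamma>A B_subset by auto
  show ?thesis
  \<comment> \<open>Equality forces \<beta> down to the rank of \<alpha>; a strictly larger
    \<open>L\<close> is what will keep the new map \<delta> nonregular.\<close>
  proof (cases "L = K")
    case True
    then have "rank \<beta> \<le>o rank \<alpha>"
      using L(3) K\<alpha> unfolding M by (meson ordIso_symmetric ordIso_ordLeq_trans)
    then show ?thesis
      using rank_eq_D_star[OF T(1) \<beta> le(1)] by simp
  next
    case False
    then obtain z where z: "z \<in> L" "z \<notin> K"
      using L(1) by blast
    \<comment> \<open>Basis points outside \<open>L\<close> are sent to \<open>d\<close>. Its choice
      within \<open>gen K\<close> ensures that the image of \<delta> is exactly
      \<open>gen L\<close>.\<close>
    obtain d where d: "d \<in> \<gamma> ` B"
      using B_nontrivial by blast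
    have dB: "d \<in> B"
      using d \<gamma>BA \<gamma>A by blast
    have "(\<lambda>x. if x \<in> L then x else d) ` X \<subseteq> B"
      using LB dB by auto
    from T_extension[OF X(3) XA this]
    obtain \<pi> where \<pi>: "\<pi> \<in> T" "\<And>x. x \<in> X \<Longrightarrow> \<pi> x = (if x \<in> L then x else d)"
      by blast
    define \<delta> where "\<delta> = mul \<gamma> \<pi>"
    have \<delta>: "\<delta> \<in> T"
      unfolding \<delta>_def by (rule mul_T[OF T(2) \<pi>(1)])
    have fix_K: "\<pi> w = w" if w: "w \<in> \<gamma> ` B" for w
    proof -
      have "K \<subseteq> A"
        using L(1) LA by simp
      then have "\<pi> w = (\<lambda>x\<in>A. x) w"
      proof (rule endomorphism_eq_gen[OF T_endo[OF \<pi>(1)] identity_endomorphism])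
        show "\<pi> x = (\<lambda>x\<in>A. x) x" if "x \<in> K" for x
        proof -
          have "x \<in> X" "x \<in> L" "x \<in> A"
            using that X(1) L(1) LA by auto
          then show ?thesis
            using \<pi>(2)[of x] by simp
        qed
      qed (simp add: K'(3) w)
      then show ?thesis
        using w \<gamma>BA \<gamma>A B_subset by auto
    qed
    have \<delta>B: "\<delta> b = \<gamma> b" if "b \<in> B" for b
      using that B_subset fix_K unfolding \<delta>_def by (simp add: map_mult_apply subset_iff)
    have "d \<in> gen L"
      using d K'(3) generated_mono[OF L(1)] by blast
    then have "\<pi> ` X \<subseteq> gen L"
      using \<pi>(2) by (auto intro: generated_base)
    moreover have "L \<subseteq> \<pi> ` X"
    proof
      fix x assume "x \<in> L"
      then show "x \<in> \<pi> ` X"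
        using \<pi>(2)[of x] L(2) by (intro image_eqI[of _ _ x]) auto
    qed
    then have "L \<subseteq> gen (\<pi> ` X)"
      by (rule subset_trans[OF _ generated_superset])
    ultimately have "gen (\<pi> ` X) = gen L"
      by (rule generated_eqI)
    then have \<delta>A: "\<delta> ` A = gen L"
      unfolding \<delta>_def mul_image using T_gen[OF \<pi>(1) XA] genX by simp
    have indepL: "independent_set F L"
      using X(3) L(2) by (rule independent_set_mono)
    \<comment> \<open>\<open>gen K\<close> is the image of \<open>B\<close> under \<delta>, so
      \<open>z\<close> witnesses that \<delta> is nonregular.\<close>
    have "z \<notin> gen K"
      using independent_subset_generated[OF indepL L(1) z(1)] z(2) by blast
    then have "gen K \<noteq> gen L"
      using generated_base[OF z(1)] by metis
    then have "\<delta> ` B \<noteq> \<delta> ` A"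
      using \<delta>A \<delta>B K'(3) by (simp cong: image_cong)
    then have "(\<gamma>, \<delta>) \<in> R_star T mul"
      by (intro R_starI_nonregular T \<delta> nonreg) (simp_all add: \<delta>B)
    then have "(\<alpha>, \<delta>) \<in> D_star T mul"
      using R R_star_subset_D_star D_star_trans by blast
    moreover have "(\<delta>, \<beta>) \<in> D_star T mul"
    proof -
      have "basis_of F (\<delta> ` A) L"
        unfolding basis_of_def \<delta>A using indepL generated_superset by simp
      from dimension_basis[OF T_subalgebra[OF \<delta> subalgebra_A] this]
      have "rank \<delta> =o rank \<beta>"
        using L(3) unfolding M by (meson ordIso_symmetric ordIso_transitive)
      then show ?thesis
        by (intro rank_eq_D_star \<delta> \<beta>) (simp_all add: ordIso_iff_ordLeq)
    qed
    ultimately show ?thesis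
      by (rule D_star_trans)
  qed
qed

section \<open>Convexity of D*-classes and comparison with J*\<close>

text \<open>By minimality of D* it suffices that \<open>E\<close>, the pairs of D*-related elements
  for which every map of intermediate rank is in the same class, is an equivalence containing L* and
  R*.\<close>

lemma D_star_convex:
  assumes "(\<alpha>, \<gamma>) \<in> D_star T mul" "\<beta> \<in> T" "rank \<alpha> \<le>o rank \<beta>" "rank \<beta> \<le>o rank \<gamma>"
  shows "(\<alpha>, \<beta>) \<in> D_star T mul"
proof -
  define between where "between \<alpha> \<beta> \<gamma> \<longleftrightarrow>
    rank \<alpha> \<le>o rank \<beta> \<and> rank \<beta> \<le>o rank \<gamma> \<or> rank \<gamma> \<le>o rank \<beta> \<and> rank \<beta> \<le>o rank \<alpha>" for \<alpha> \<beta> \<gamma>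
  define E where "E = {(\<alpha>, \<gamma>) \<in> D_star T mul. \<forall>\<beta> \<in> T. between \<alpha> \<beta> \<gamma> \<longrightarrow> (\<alpha>, \<beta>) \<in> D_star T mul}"
  have E_I: "(\<alpha>, \<gamma>) \<in> E"
    if "(\<alpha>, \<gamma>) \<in> D_star T mul"
      "\<And>\<beta>. \<beta> \<in> T \<Longrightarrow> between \<alpha> \<beta> \<gamma> \<Longrightarrow> (\<alpha>, \<beta>) \<in> D_star T mul" for \<alpha> \<gamma>
    using that unfolding E_def by simp
  have E_D: "(\<alpha>, \<gamma>) \<in> D_star T mul"
    "\<And>\<beta>. \<beta> \<in> T \<Longrightarrow> between \<alpha> \<beta> \<gamma> \<Longrightarrow> (\<alpha>, \<beta>) \<in> D_star T mul" if "(\<alpha>, \<gamma>) \<in> E" for \<alpha> \<gamma>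
    using that unfolding E_def by auto
  have same_rank: "(\<alpha>, \<gamma>) \<in> E"
    if T: "\<alpha> \<in> T" "\<gamma> \<in> T" and le: "rank \<alpha> \<le>o rank \<gamma>" "rank \<gamma> \<le>o rank \<alpha>" for \<alpha> \<gamma>
  proof (rule E_I)
    show "(\<alpha>, \<gamma>) \<in> D_star T mul"
      by (rule rank_eq_D_star[OF T le])
    fix \<beta> assume \<beta>: "\<beta> \<in> T" "between \<alpha> \<beta> \<gamma>"
    then have "rank \<alpha> \<le>o rank \<beta>" "rank \<beta> \<le>o rank \<alpha>"
      using le ordLeq_transitive unfolding between_def by blast+
    then show "(\<alpha>, \<beta>) \<in> D_star T mul"
      by (rule rank_eq_D_star[OF T(1) \<beta>(1)])
  qed
  have "equiv T E"
  proof (rule equivI)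
    show "E \<subseteq> T \<times> T"
      using E_D(1) D_star_T by auto
    show "refl_on T E"
      by (intro refl_onI same_rank rank_refl)
    show "sym E"
    proof (rule symI, rule E_I)
      fix \<alpha> \<gamma> assume E: "(\<alpha>, \<gamma>) \<in> E"
      then show "(\<gamma>, \<alpha>) \<in> D_star T mul"
        by (rule D_star_sym[OF E_D(1)])
      fix \<beta> assume "\<beta> \<in> T" "between \<gamma> \<beta> \<alpha>"
      then have "(\<alpha>, \<beta>) \<in> D_star T mul"
        by (intro E_D(2)[OF E]) (auto simp: between_def)
      then show "(\<gamma>, \<beta>) \<in> D_star T mul"
        using D_star_trans[OF D_star_sym[OF E_D(1)[OF E]]] by simp
    qed
    show "trans E"
    proof (rule transI, rule E_I)
      fix \<alpha> \<gamma> \<delta> assume E: "(\<alpha>, \<gamma>) \<in> E" "(\<gamma>, \<delta>) \<in> E"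
      then show "(\<alpha>, \<delta>) \<in> D_star T mul"
        using D_star_trans E_D(1) by metis
      fix \<beta> assume \<beta>: "\<beta> \<in> T" "between \<alpha> \<beta> \<delta>"
      have "\<gamma> \<in> T"
        using D_star_T[OF E_D(1)[OF E(1)]] by simp
      \<comment> \<open>Ranks are comparable, so a rank between those of \<alpha> and \<delta> lies
        on one side of the rank of \<gamma>.\<close>
      then consider "between \<alpha> \<beta> \<gamma>" | "between \<gamma> \<beta> \<delta>"
        using rank_total[OF \<beta>(1), of \<gamma>] \<beta>(2) unfolding between_def by blast
      then show "(\<alpha>, \<beta>) \<in> D_star T mul"
      proof cases
        case 1
        then show ?thesis
          by (rule E_D(2)[OF E(1) \<beta>(1)])
      next
        case 2
        then have "(\<gamma>, \<beta>) \<in> D_star T mul"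
          by (rule E_D(2)[OF E(2) \<beta>(1)])
        then show ?thesis
          by (rule D_star_trans[OF E_D(1)[OF E(1)]])
      qed
    qed
  qed
  moreover have "L_star T mul \<subseteq> E"
  proof (rule subrelI)
    fix \<alpha> \<gamma> assume L: "(\<alpha>, \<gamma>) \<in> L_star T mul"
    have "rank \<alpha> = rank \<gamma>"
      by (simp add: L_star_image[OF L])
    moreover have "\<alpha> \<in> T" "\<gamma> \<in> T"
      using L unfolding L_star_def by simp_all
    ultimately show "(\<alpha>, \<gamma>) \<in> E"
      using rank_refl by (intro same_rank) simp_all
  qed
  moreover have "R_star T mul \<subseteq> E"
  proof (rule subrelI, rule E_I)
    fix \<alpha> \<gamma> assume R: "(\<alpha>, \<gamma>) \<in> R_star T mul"
    then show D: "(\<alpha>, \<gamma>) \<in> D_star T mul"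
      by (rule subsetD[OF R_star_subset_D_star])
    fix \<beta> assume \<beta>: "\<beta> \<in> T" "between \<alpha> \<beta> \<gamma>"
    from \<beta>(2) show "(\<alpha>, \<beta>) \<in> D_star T mul"
      unfolding between_def
    proof (elim disjE conjE)
      assume "rank \<alpha> \<le>o rank \<beta>" "rank \<beta> \<le>o rank \<gamma>"
      then show ?thesis
        by (rule R_star_convex[OF R \<beta>(1)])
    next
      assume "rank \<gamma> \<le>o rank \<beta>" "rank \<beta> \<le>o rank \<alpha>"
      then have "(\<gamma>, \<beta>) \<in> D_star T mul"
        by (rule R_star_convex[OF R_star_sym[OF R] \<beta>(1)])
      then show ?thesis
        by (rule D_star_trans[OF D])
    qed
  qed
  ultimately have "D_star T mul \<subseteq> E"
    by (rule D_star_least)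
  then have "(\<alpha>, \<gamma>) \<in> E"
    using assms(1) by blast
  then show ?thesis
    using E_D(2) assms(2-4) unfolding between_def by blast
qed

text \<open>Membership of \<beta> in the ideal \<open>I\<close> gives a \<delta> in the class of
  \<alpha> whose rank is at least that of \<beta>; convexity between \<alpha> and \<delta> then
  captures \<beta>.\<close>

lemma J_star_rank_le:
  assumes J: "(\<alpha>, \<beta>) \<in> J_star T mul" and le: "rank \<alpha> \<le>o rank \<beta>"
  shows "(\<alpha>, \<beta>) \<in> D_star T mul"
proof -
  have T: "\<alpha> \<in> T" "\<beta> \<in> T"
    using J unfolding J_star_def by auto
  define I where "I = {\<gamma> \<in> T. \<exists>\<delta>. (\<alpha>, \<delta>) \<in> D_star T mul \<and> rank \<gamma> \<le>o rank \<delta>}"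
  have "(\<alpha>, \<alpha>) \<in> D_star T mul"
    using equiv_D_star T(1) by (meson equivE refl_onD)
  then have "\<alpha> \<in> I"
    using T(1) rank_refl unfolding I_def by blast
  have "mul \<sigma> \<gamma> \<in> I \<and> mul \<gamma> \<sigma> \<in> I" if \<sigma>: "\<sigma> \<in> T" and \<gamma>: "\<gamma> \<in> I" for \<sigma> \<gamma>
  proof -
    obtain \<delta> where \<delta>: "\<gamma> \<in> T" "(\<alpha>, \<delta>) \<in> D_star T mul" "rank \<gamma> \<le>o rank \<delta>"
      using \<gamma> unfolding I_def by blast
    have "rank (mul \<sigma> \<gamma>) \<le>o rank \<delta>" "rank (mul \<gamma> \<sigma>) \<le>o rank \<delta>"
      using rank_mul_le(2)[OF \<sigma> \<delta>(1)] rank_mul_le(1)[OF \<delta>(1) \<sigma>] \<delta>(3)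
        ordLeq_transitive by blast+
    then show ?thesis
      unfolding I_def using mul_T \<sigma> \<delta>(1,2) by blast
  qed
  then have ideal: "two_sided_ideal T mul I"
    unfolding two_sided_ideal_def using \<open>\<alpha> \<in> I\<close> by (auto simp: I_def)
  have closed: "\<gamma>' \<in> I" if D: "(\<gamma>, \<gamma>') \<in> D_star T mul" and "\<gamma> \<in> I" for \<gamma> \<gamma>'
  proof -
    obtain \<delta> where \<delta>: "(\<alpha>, \<delta>) \<in> D_star T mul" "rank \<gamma> \<le>o rank \<delta>"
      using \<open>\<gamma> \<in> I\<close> unfolding I_def by blast
    have T': "\<gamma>' \<in> T" "\<delta> \<in> T"
      using D_star_T D \<delta>(1) by auto
    consider "rank \<gamma>' \<le>o rank \<delta>" | "rank \<delta> \<le>o rank \<gamma>'"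
      using rank_total[OF T'] by blast
    then show ?thesis
    proof cases
      case 1
      then show ?thesis
        unfolding I_def using T'(1) \<delta>(1) by blast
    next
      case 2
      \<comment> \<open>The rank of \<delta> lies between those of the related maps \<gamma> and
        \<gamma>', so convexity puts \<gamma>' into the class of \<alpha>.\<close>
      have "(\<gamma>, \<delta>) \<in> D_star T mul"
        by (rule D_star_convex[OF D T'(2) \<delta>(2) 2])
      then have "(\<alpha>, \<gamma>') \<in> D_star T mul"
        using D \<delta>(1) D_star_trans D_star_sym by metis
      then show ?thesis
        unfolding I_def using T'(1) rank_refl by blast
    qed
  qed
  have "I \<subseteq> T"
    unfolding I_def by blast
  have "saturated_by T (L_star T mul) I" "saturated_by T (R_star T mul) I"
    unfolding saturated_by_iff[OF equiv_L_star] saturated_by_iff[OF equiv_R_star]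
    using \<open>I \<subseteq> T\<close> closed subsetD[OF L_star_subset_D_star] subsetD[OF R_star_subset_D_star]
    by blast+
  then have "J_star_ideal T mul \<alpha> \<subseteq> I"
    unfolding J_star_ideal_def using ideal \<open>\<alpha> \<in> I\<close> by (intro Inter_lower) simp
  moreover have "\<beta> \<in> J_star_ideal T mul \<beta>"
    unfolding J_star_ideal_def by simp
  ultimately have "\<beta> \<in> I"
    using J unfolding J_star_def by auto
  then obtain \<delta> where "(\<alpha>, \<delta>) \<in> D_star T mul" "rank \<beta> \<le>o rank \<delta>"
    unfolding I_def by blast
  then show ?thesis
    using D_star_convex[OF _ T(2) le] by blast
qed

lemma D_star_eq_J_star: "D_star T mul = J_star T mul"
proof
  show "J_star T mul \<subseteq> D_star T mul"
  proof (rule subrelI)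
    fix \<alpha> \<beta> assume J: "(\<alpha>, \<beta>) \<in> J_star T mul"
    then have J': "(\<beta>, \<alpha>) \<in> J_star T mul" and "\<alpha> \<in> T" "\<beta> \<in> T"
      unfolding J_star_def by auto
    then show "(\<alpha>, \<beta>) \<in> D_star T mul"
      using rank_total J_star_rank_le[OF J] J_star_rank_le[OF J'] D_star_sym by blast
  qed
qed (rule D_star_subset_J_star)

end

theorem proposition6p14:
  fixes A B :: "'a set" and F :: "'a operation set"
  assumes "independence_algebra A F"
    and "subalgebra A F B" and "B \<noteq> {}" and "B \<noteq> A"
    and "ctwo \<le>o dimension F B \<or>
         (generated F {} \<noteq> {} \<and> dimension F B =o cone)"
  shows "D_star (T_sgp A F B) (map_mult A) = J_star (T_sgp A F B) (map_mult A)"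
proof -
  interpret indep_algebra A F
    using assms(1) by unfold_locales
  obtain X where X: "basis_of F B X" "dimension F B = |X|"
    using subalgebra_basis[OF assms(2)] by metis
  note X' = basis_ofD[OF X(1)]
  \<comment> \<open>Either \<open>B\<close> has two basis points, or it has a basis point and a
    constant, which differ because a basis point is not in \<open>generated F {}\<close>.\<close>
  have "\<exists>b \<in> B. \<exists>c \<in> B. b \<noteq> c"
    using assms(5)
  proof
    assume "ctwo \<le>o dimension F B"
    then have "|UNIV :: bool set| \<le>o |X|"
      unfolding ctwo_def X(2) .
    then obtain f :: "bool \<Rightarrow> 'a" where "inj f" "range f \<subseteq> X"
      unfolding card_of_ordLeq[symmetric] by blast
    then show ?thesis
      using X'(1) by (metis injD rangeI subsetD)
  next
    assume const: "generated F {} \<noteq> {} \<and> dimension F B =o cone"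
    then obtain c where c: "c \<in> generated F {}"
      by blast
    have "X \<noteq> {}"
      using const unfolding X(2) cone_def
      by (metis card_of_empty3 insert_not_empty ordIso_iff_ordLeq)
    then obtain x where x: "x \<in> X"
      by blast
    have "c \<in> B"
      using c generated_mono[of "{}" X F] X'(3) by blast
    moreover have "x \<noteq> c"
      using independent_subset_generated[OF X'(2) _ x, of "{}"] c by blast
    ultimately show ?thesis
      using x X'(1) by blast
  qed
  then interpret restricted_range A F B
    using assms(2,4) by unfold_locales
  show ?thesis
    by (rule D_star_eq_J_star)
qed

end
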